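(* Let $n, l, k$ be positive integers such that $l/k < 1/n$, and let $\beta \in \mathbb{R}$. Then for every $x\in\mathbb{R}$ the Mittag-Leffler function of Le Roy type $F^{(n)}_{l/k,\beta}(-x)$ is given by the Laplace transform $$F^{(n)}_{\frac{l}{k}, \beta}(-x) = \int_{0}^{\infty} e^{-xy}\, m_{\frac{l}{k}, \beta}(n; y)\, dy$$ with the weight function, defined for $y>0$ by $$m_{\frac{l}{k}, \beta}(n; y) = (2\pi)^{\frac{1-k}{2}-\frac{n(1-l)}{2}}\, \frac{k^{3/2}}{l^{n(\beta-\frac{1}{2})}}\, \frac{1}{y}\; G^{k, 0}_{nl, k}\bigg(\frac{l^{nl} y^{k}}{k^{k}}\,\Big|\, {\overbrace{\Delta(l, \beta), \ldots, \Delta(l, \beta)}^{n\ \text{times}} \atop \Delta(k, 1)} \bigg).$$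
   Context: For $\alpha>0$, $\beta\in\mathbb{R}$ and a positive integer $n$, the Mittag-Leffler function of Le Roy type (MLR function) is the entire function $F^{(n)}_{\alpha,\beta}(z)=\sum_{r=0}^{\infty} \frac{z^{r}}{[\Gamma(\beta+\alpha r)]^{n}}$, where $1/\Gamma$ is taken to be $0$ at the poles of $\Gamma$. For a positive integer $r$ and $\lambda\in\mathbb{R}$, $\Delta(r,\lambda)$ denotes the list of $r$ elements $\frac{\lambda}{r}, \frac{\lambda+1}{r},\ldots,\frac{\lambda+r-1}{r}$. The Meijer $G$ function is defined by the Mellin-Barnes integral $$G^{m,n}_{p,q}\Big(z\,\Big|\,{a_1,\ldots,a_p \atop b_1,\ldots,b_q}\Big)=\frac{1}{2\pi i}\int_{\gamma_L} \frac{\prod_{i=1}^{m}\Gamma(b_i+s)\prod_{i=1}^{n}\Gamma(1-a_i-s)}{\prod_{i=n+1}^{p}\Gamma(a_i+s)\prod_{i=m+1}^{q}\Gamma(1-b_i-s)}\, z^{-s}\,ds,$$ with empty products equal to $1$ and $\gamma_L$ the standard contour separating the poles of the $\Gamma(b_i+s)$ from those of the $\Gamma(1-a_i-s)$. In particular, $G^{k,0}_{nl,k}$ has integrand $\frac{\prod_{i=1}^{k}\Gamma(b_i+s)}{\prod_{i=1}^{nl}\Gamma(a_i+s)}z^{-s}$, and the contour may be taken to be a vertical line lying to the right of all poles of the numerator. *)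

theory Defs
  imports "HOL-Analysis.Analysis"
begin

text \<open>The reciprocal Gamma function \<^const>\<open>rGamma\<close> vanishes at the poles of \<^const>\<open>Gamma\<close>,
  which is the convention \<open>1 / \<Gamma> = 0\<close> used throughout.\<close>

definition mittag_leffler_leroy :: "nat \<Rightarrow> real \<Rightarrow> real \<Rightarrow> complex \<Rightarrow> complex" where
  "mittag_leffler_leroy n \<alpha> \<beta> z =
     (\<Sum>r. z ^ r * complex_of_real (rGamma (\<beta> + \<alpha> * real r) ^ n))"

definition Delta :: "nat \<Rightarrow> real \<Rightarrow> real list" where
  "Delta r u = map (\<lambda>j. (u + real j) / real r) [0..<r]"

text \<open>In \<open>G\<^bsup>m,n\<^esup>\<^bsub>p,q\<^esub>\<close> the parameters \<open>a\<^sub>1, \<dots>, a\<^sub>p\<close> and \<open>b\<^sub>1, \<dots>, b\<^sub>q\<close> are the lists \<open>as\<close> and \<open>bs\<close>,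
  so that \<open>p\<close> and \<open>q\<close> are their lengths; indices are shifted to start at \<open>0\<close>.\<close>

definition meijer_G_integrand ::
  "nat \<Rightarrow> nat \<Rightarrow> complex list \<Rightarrow> complex list \<Rightarrow> complex \<Rightarrow> complex \<Rightarrow> complex" where
  "meijer_G_integrand m n as bs z s =
     (\<Prod>i<m. Gamma (bs ! i + s)) * (\<Prod>i<n. Gamma (1 - as ! i - s)) *
     (\<Prod>i=n..<length as. rGamma (as ! i + s)) *
     (\<Prod>i=m..<length bs. rGamma (1 - bs ! i - s)) * z powr (- s)"

text \<open>The vertical line \<open>Re s = c\<close> has the poles of all \<open>\<Gamma>(b\<^sub>i + s)\<close> on its left and the poles of
  all \<open>\<Gamma>(1 - a\<^sub>i - s)\<close> on its right.\<close>

definition separates_poles ::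
  "nat \<Rightarrow> nat \<Rightarrow> complex list \<Rightarrow> complex list \<Rightarrow> real \<Rightarrow> bool" where
  "separates_poles m n as bs c \<longleftrightarrow>
     (\<forall>i<m. \<forall>s. bs ! i + s \<in> \<int>\<^sub>\<le>\<^sub>0 \<longrightarrow> Re s < c) \<and>
     (\<forall>i<n. \<forall>s. 1 - as ! i - s \<in> \<int>\<^sub>\<le>\<^sub>0 \<longrightarrow> c < Re s)"

text \<open>The Mellin-Barnes integral is taken along a separating vertical line, parametrised by
  \<open>s = c + \<i> t\<close>, \<open>ds = \<i> dt\<close>. For \<open>n = 0\<close> any line to the right of all poles of the numerator
  separates. Parameters that would require an indented or a loop contour are not covered.\<close>

definition has_meijer_G ::
  "nat \<Rightarrow> nat \<Rightarrow> complex list \<Rightarrow> complex list \<Rightarrow> complex \<Rightarrow> complex \<Rightarrow> bool" where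
  "has_meijer_G m n as bs z w \<longleftrightarrow>
     (\<exists>c. separates_poles m n as bs c \<and>
          integrable lborel (\<lambda>t. meijer_G_integrand m n as bs z (Complex c t)) \<and>
          w = 1 / (2 * complex_of_real pi * \<i>) *
              (\<integral>t. meijer_G_integrand m n as bs z (Complex c t) * \<i> \<partial>lborel))"

text \<open>The description operator refers to the common value of these integrals: it is
  meaningful only if the value exists and does not depend on the choice of \<open>c\<close>.\<close>

definition meijer_G ::
  "nat \<Rightarrow> nat \<Rightarrow> complex list \<Rightarrow> complex list \<Rightarrow> complex \<Rightarrow> complex" where
  "meijer_G m n as bs z = (THE w. has_meijer_G m n as bs z w)"

definition leroy_weight :: "nat \<Rightarrow> nat \<Rightarrow> real \<Rightarrow> nat \<Rightarrow> real \<Rightarrow> complex" where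
  "leroy_weight l k \<beta> n y =
     complex_of_real
       ((2 * pi) powr ((1 - real k) / 2 - real n * (1 - real l) / 2) *
        (real k powr (3 / 2) / real l powr (real n * (\<beta> - 1 / 2))) * (1 / y)) *
     meijer_G k 0
       (map complex_of_real (concat (replicate n (Delta l \<beta>))))
       (map complex_of_real (Delta k 1))
       (complex_of_real (real l ^ (n * l) * y ^ k / real k ^ k))"

end

(* By Gauss's multiplication formula the Mellin-Barnes integrand is, after u = k s and with
   alpha = l / k, the function H(u) = Gamma(u + 1) / Gamma(alpha u + beta)^n times y^(-u), so the
   weight is the inverse Mellin transform m(y) = 1 / (2 pi) * integral of H(c + i t) y^(- c - 1 - i t) dt.
   Since n alpha < 1, H decays exponentially on vertical lines, so c > -1 may be chosen freely.
   Splitting the integral of y^r m(y) at y = 1 and using the lines c = r - 1/2 and c = r + 1/2, Fubini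
   and Cauchy's formula give the moment H(r) = r! / Gamma(alpha r + beta)^n.  The L1 norms of H on these
   lines are o(r! eps^r) for every eps > 0, which allows the exponential series of exp(- x y) to be
   integrated term by term.  The Gamma bounds need no Stirling formula: |Gamma(s + i t)| / Gamma(s)
   increases with s, and |Gamma(1/2 + i t)|^2 = pi / cosh(pi t). *)

theory Submission
  imports Defs "HOL-Complex_Analysis.Complex_Analysis"
begin

subsection \<open>Gauss multiplication formula\<close>

text \<open>No single line can produce a moment by Fubini: on Re u = c the modulus of y^(r - u - 1)
  fails to be integrable at infinity if c <= r and at 0 if c >= r. This forces the split at y = 1
  with one line on each side of r, and the moment appears as the residue between them. The weight is
  not known to have constant sign, so its absolute moments cannot be read off from the moments. They
  are bounded through the L1 norms of H, with bounds strong enough for x < 0 as well, where exp(- x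
  y) grows. The two directions of the u-plane use different facts. In the imaginary direction n
  \<alpha> < 1 lets the decay of Gamma(u + 1) win over the growth of the reciprocal factors. In the
  real direction n \<alpha> > 0 makes 1 / Gamma(\<alpha> r + \<beta>)^n smaller than every geometric
  sequence, which is the source of eps^r. The freedom to move the line also makes the description in
  \<open>meijer_G\<close> meaningful, since all admissible lines have to give the same
  value.\<close>

text \<open>This is 1 + X + ... + X^(k-1), factored over the nontrivial k-th roots of unity, at X =
  1. The factorization holds because both sides are monic of degree k - 1 and vanish at these k - 1
  points.\<close>

lemma prod_one_minus_roots_of_unity:
  assumes "k > 0"
  shows "(\<Prod>i=1..<k. 1 - cis (2 * pi * real i / real k)) = of_nat k"
proof -
  let ?w = "\<lambda>i. cis (2 * pi * real i / real k)"
  define p q where "p = (\<Prod>i=1..<k. [:- ?w i, 1:])" and "q = (\<Sum>j<k. monom (1::complex) j)"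
  have inj: "inj_on ?w {..<k}"
    using Complex.bij_betw_roots_unity[OF assms] by (simp add: bij_betw_def)
  have "p = q"
  proof (rule poly_eqI_degree_lead_coeff)
    have deg: "degree p = k - 1"
      by (simp add: p_def degree_prod_eq_sum_degree)
    then show "degree p \<le> k - 1" by simp
    have "lead_coeff p = 1"
      by (simp add: p_def lead_coeff_prod)
    moreover have "coeff q (k - 1) = (\<Sum>j<k. if j = k - 1 then 1 else 0)"
      by (auto simp: q_def coeff_sum intro!: sum.cong)
    ultimately show "coeff p (k - 1) = coeff q (k - 1)"
      using assms deg by simp
    show "degree q \<le> k - 1"
      unfolding q_def by (intro degree_sum_le) (auto intro: order_trans[OF degree_monom_le])
    show "k - 1 \<le> card (?w ` {1..<k})"
      using inj by (subst card_image) (auto intro: inj_on_subset)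
    fix z assume "z \<in> ?w ` {1..<k}"
    then obtain i where i: "i \<in> {1..<k}" "z = ?w i" by auto
    have "?w i \<noteq> ?w 0"
      using inj_onD[OF inj, of i 0] i assms by auto
    then have "z \<noteq> 1" using i by simp
    moreover have "z ^ k = 1"
      using Complex.bij_betw_roots_unity[OF assms] i by (auto simp: bij_betw_def)
    ultimately have "poly q z = 0"
      by (simp add: q_def poly_sum poly_monom geometric_sum)
    moreover have "poly p z = 0"
      using i by (auto simp: p_def poly_prod)
    ultimately show "poly p z = poly q z" by simp
  qed
  then have "poly p 1 = poly q 1" by simp
  then show ?thesis by (simp add: p_def q_def poly_prod poly_sum poly_monom)
qed

text \<open>Take moduli in the preceding product: |1 - exp(2 i t)| = 2 sin t for t between 0 and
  pi.\<close>

lemma prod_sin_pi_fraction: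
  assumes "k > 0"
  shows "(\<Prod>i=1..<k. sin (pi * real i / real k)) = real k / 2 ^ (k - 1)"
proof -
  have "norm (1 - cis (2 * pi * real i / real k)) = 2 * sin (pi * real i / real k)"
    if "i \<in> {1..<k}" for i
  proof -
    let ?t = "pi * real i / real k"
    have "?t \<ge> 0" "?t \<le> pi" using that by (auto simp: field_simps)
    then have "sin ?t \<ge> 0" by (rule sin_ge_zero)
    have "1 - cis (2 * ?t) = Complex (2 * (sin ?t)\<^sup>2) (- (2 * sin ?t * cos ?t))"
      unfolding complex_eq_iff by (simp only: cis.sel minus_complex.sel one_complex.sel complex.sel cos_double_sin sin_double) simp
    also have "\<dots> = complex_of_real (2 * sin ?t) * Complex (sin ?t) (- cos ?t)"
      by (simp add: complex_eq_iff power2_eq_square)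
    finally have "norm (1 - cis (2 * ?t)) = norm (complex_of_real (2 * sin ?t) * Complex (sin ?t) (- cos ?t))"
      by simp
    also have "\<dots> = 2 * sin ?t"
      using \<open>sin ?t \<ge> 0\<close> unfolding norm_mult norm_of_real by (simp add: complex_norm)
    finally show ?thesis by (simp only: times_divide_eq_right mult.assoc)
  qed
  then have "(\<Prod>i=1..<k. 2 * sin (pi * real i / real k))
      = norm (\<Prod>i=1..<k. 1 - cis (2 * pi * real i / real k))"
    by (simp add: prod_norm[symmetric])
  also have "\<dots> = real k"
    by (simp only: prod_one_minus_roots_of_unity[OF assms] norm_of_nat)
  finally show ?thesis by (simp add: prod.distrib field_simps)
qed

text \<open>The factor at i = k - 1 is \<open>rGamma 1 = 1\<close>. Pairing i/k with 1 - i/k by the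
  reflection formula turns the square of the remaining product into a product of sines; positivity
  selects the root.\<close>

lemma prod_rGamma_fractions:
  assumes "k > 0"
  shows "(\<Prod>i<k. rGamma ((1 + real i) / real k)) = sqrt (real k) * (2 * pi) powr ((1 - real k) / 2)"
proof -
  define P where "P = (\<Prod>i=1..<k. rGamma (real i / real k))"
  have "(\<Prod>i<k. rGamma ((1 + real i) / real k)) = (\<Prod>i\<in>{1..<Suc k}. rGamma (real i / real k))"
    by (rule prod.reindex_bij_witness[of _ "\<lambda>i. i - 1" Suc]) auto
  also have "\<dots> = P"
    using assms by (simp add: P_def)
  finally have eq: "(\<Prod>i<k. rGamma ((1 + real i) / real k)) = P" .
  have P': "P = (\<Prod>i=1..<k. rGamma (1 - real i / real k))"
    unfolding P_def
    by (rule prod.reindex_bij_witness[of _ "\<lambda>i. k - i" "\<lambda>i. k - i"])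
       (auto simp: of_nat_diff field_simps)
  have refl: "rGamma x * rGamma (1 - x) = sin (pi * x) / pi" for x :: real
  proof -
    have "complex_of_real (rGamma x * rGamma (1 - x)) = complex_of_real (sin (pi * x) / pi)"
      using rGamma_reflection_complex[of "of_real x"]
      by (simp flip: rGamma_complex_of_real sin_of_real)
    then show ?thesis by (simp only: of_real_eq_iff)
  qed
  have "P\<^sup>2 = (\<Prod>i=1..<k. rGamma (real i / real k) * rGamma (1 - real i / real k))"
    unfolding power2_eq_square prod.distrib by (metis P' P_def)
  also have "\<dots> = (\<Prod>i=1..<k. sin (pi * real i / real k) / pi)"
    by (simp only: refl) simp
  also have "\<dots> = real k / 2 ^ (k - 1) / pi ^ (k - 1)"
    using prod_sin_pi_fraction[OF assms] by (simp add: prod_dividef)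
  also have "\<dots> = real k * (2 * pi) powr (1 - real k)"
  proof -
    have "(2 * pi) powr (1 - real k) = (2 * pi) powr (- real (k - 1))"
      using assms by (simp add: of_nat_diff)
    also have "\<dots> = inverse ((2 * pi) ^ (k - 1))"
      by (simp add: powr_minus powr_realpow)
    finally show ?thesis by (simp add: power_mult_distrib field_simps)
  qed
  also have "\<dots> = (sqrt (real k) * (2 * pi) powr ((1 - real k) / 2))\<^sup>2"
    by (simp add: power_mult_distrib powr_half_sqrt flip: powr_powr[of "2 * pi" "1 - real k" "1 / 2", simplified])
  finally have "P\<^sup>2 = (sqrt (real k) * (2 * pi) powr ((1 - real k) / 2))\<^sup>2" .
  moreover have "P \<ge> 0"
    unfolding P_def by (intro prod_nonneg) (auto simp: rGamma_inverse_Gamma intro!: less_imp_le Gamma_real_pos)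
  ultimately have "P = sqrt (real k) * (2 * pi) powr ((1 - real k) / 2)"
    by (subst (asm) power2_eq_iff_nonneg) auto
  with eq show ?thesis by simp
qed

text \<open>Finite form of the multiplication formula. Passing from n to n + 1 appends to the rising
  factorial of k z one block of k consecutive factors, one from each residue class modulo k.\<close>

lemma prod_pochhammer_fractions:
  fixes z :: "'a :: field_char_0"
  assumes "k > 0"
  shows "(\<Prod>i<k. pochhammer (z + of_nat i / of_nat k) n) = 
           pochhammer (of_nat k * z) (k * n) / of_nat k ^ (k * n)"
proof (induction n)
  case (Suc n)
  have "pochhammer (of_nat k * z + of_nat (k * n)) k =
      (\<Prod>i<k. of_nat k * (z + of_nat i / of_nat k + of_nat n))"
    unfolding pochhammer_prod atLeast0LessThan
    using assms by (intro prod.cong) (auto simp: field_simps)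
  also have "\<dots> = of_nat k ^ k * (\<Prod>i<k. z + of_nat i / of_nat k + of_nat n)"
    by (simp add: prod.distrib)
  finally have "pochhammer (of_nat k * z) (k * n + k) = pochhammer (of_nat k * z) (k * n) *
      (of_nat k ^ k * (\<Prod>i<k. z + of_nat i / of_nat k + of_nat n))"
    by (simp only: pochhammer_product')
  then show ?case
    using Suc assms unfolding pochhammer_Suc prod.distrib
    by (simp add: power_add add.commute[of k])
qed auto

text \<open>Splitting the partial product of length \<open>k (n + 1)\<close> for \<open>1 / \<Gamma> (k z)\<close> into residue classes
  modulo \<open>k\<close> leaves a factor that does not depend on \<open>z\<close>; its limit is read off at \<open>z = 1 / k\<close>.\<close>

theorem rGamma_Gauss_multiplication:
  fixes z :: complex
  assumes "k > 0"
  shows "(\<Prod>i<k. rGamma (z + of_nat i / of_nat k)) =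
           of_real ((2 * pi) powr ((1 - real k) / 2) * real k powr (- 1 / 2)) *
           exp (of_nat k * z * of_real (ln (real k))) * rGamma (of_nat k * z)"
proof -
  \<comment> \<open>\<open>rGamma_series w N\<close> has N + 1 linear factors, so this index gives
    exactly k (n + 1) of them.\<close>
  define N where "N n = k * (n + 1) - 1" for n
  \<comment> \<open>\<open>E\<close> collects everything free of z. The exponentials n^(- k z) and
    N^(k z) that remain combine to exp(k z \<open>D n\<close>), and N / n tends to k.\<close>
  define E :: "nat \<Rightarrow> complex" where "E n = fact (N n) / (of_nat k ^ (k * (n + 1)) * fact n ^ k *
    (\<Prod>i<k. exp (of_nat i / of_nat k * of_real (ln (of_nat n)))))" for n
  define D where "D n = ln (real (N n)) - ln (real n)" for n
  have N: "filterlim N at_top sequentially"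
    unfolding N_def using assms
    by (intro filterlim_at_top_mono[OF filterlim_ident] always_eventually) (cases k; auto)
  have "(\<lambda>n. real (N n) / real n) \<longlonglongrightarrow> real k"
  proof (rule Lim_transform_eventually)
    show "(\<lambda>n. real k + (real k - 1) / real n) \<longlonglongrightarrow> real k"
      by (rule tendsto_eq_intros lim_const_over_n refl)+ simp
    show "\<forall>\<^sub>F n in sequentially. real k + (real k - 1) / real n = real (N n) / real n"
      using eventually_gt_at_top[of 0]
    proof eventually_elim
      case (elim n)
      have "real (N n) = real k * (real n + 1) - 1"
        unfolding N_def using assms by (subst of_nat_diff) (auto simp: distrib_left)
      with elim show ?case by (simp add: add_divide_distrib diff_divide_distrib distrib_left)
    qed
  qed
  then have "(\<lambda>n. ln (real (N n) / real n)) \<longlonglongrightarrow> ln (real k)"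
    using assms by (intro tendsto_ln) auto
  then have D: "D \<longlonglongrightarrow> ln (real k)"
  proof (rule Lim_transform_eventually)
    show "\<forall>\<^sub>F n in sequentially. ln (real (N n) / real n) = D n"
      using eventually_gt_at_top[of 0] N[unfolded filterlim_at_top, rule_format, of 1]
      by eventually_elim (auto simp: D_def ln_div)
  qed
  have step: "(\<Prod>i<k. rGamma_series (z + of_nat i / of_nat k) n) =
      rGamma_series (of_nat k * z) (N n) * exp (of_nat k * z * of_real (D n)) * E n"
    for z :: complex and n
  proof -
    have Suc_N: "Suc (N n) = k * (n + 1)" using assms by (simp add: N_def)
    have "(\<Prod>i<k. rGamma_series (z + of_nat i / of_nat k) n) =
       (\<Prod>i<k. pochhammer (z + of_nat i / of_nat k) (n + 1)) / (fact n ^ k * 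
        (exp (of_nat k * z * of_real (ln (of_nat n))) *
         (\<Prod>i<k. exp (of_nat i / of_nat k * of_real (ln (of_nat n))))))"
      unfolding rGamma_series_def prod_dividef prod.distrib prod_constant card_lessThan
        distrib_right exp_add
      by (simp only: exp_of_nat_mult mult.assoc)
    also have "\<dots> = pochhammer (of_nat k * z) (Suc (N n)) / of_nat k ^ (k * (n + 1)) / (fact n ^ k * 
        (exp (of_nat k * z * of_real (ln (of_nat n))) *
         (\<Prod>i<k. exp (of_nat i / of_nat k * of_real (ln (of_nat n))))))"
      by (simp only: prod_pochhammer_fractions[OF assms] Suc_N)
    also have "\<dots> = rGamma_series (of_nat k * z) (N n) * exp (of_nat k * z * of_real (D n)) * E n"
      unfolding rGamma_series_def E_def D_def of_real_diff right_diff_distrib exp_diff by simp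
    finally show ?thesis .
  qed
  have lim1: "(\<lambda>n. rGamma_series (of_nat k * z) (N n) * exp (of_nat k * z * of_real (D n)))
      \<longlonglongrightarrow> rGamma (of_nat k * z) * exp (of_nat k * z * of_real (ln (real k)))" for z :: complex
    using filterlim_compose[OF rGamma_series_LIMSEQ N] by (intro tendsto_intros D) 
  have lim2: "(\<lambda>n. \<Prod>i<k. rGamma_series (z + of_nat i / of_nat k) n)
      \<longlonglongrightarrow> (\<Prod>i<k. rGamma (z + of_nat i / of_nat k))" for z :: complex
    by (intro tendsto_intros)
  define P where "P = (\<Prod>i<k. rGamma (1 / of_nat k + of_nat i / of_nat k :: complex))"
  have P: "P = of_real (sqrt (real k) * (2 * pi) powr ((1 - real k) / 2))"
    unfolding prod_rGamma_fractions[OF assms, symmetric] P_def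
    by (simp add: add_divide_distrib flip: rGamma_complex_of_real)
  have "E \<longlonglongrightarrow> P / of_nat k"
  proof (rule Lim_transform_eventually)
    let ?A = "\<lambda>n. rGamma_series (1 :: complex) (N n) * exp (of_real (D n))"
    have lim: "?A \<longlonglongrightarrow> of_nat k"
      using lim1[of "1 / of_nat k"] assms by (simp add: exp_of_real)
    then show "(\<lambda>n. (\<Prod>i<k. rGamma_series (1 / of_nat k + of_nat i / of_nat k) n) / ?A n)
      \<longlonglongrightarrow> P / of_nat k"
      unfolding P_def using assms by (intro tendsto_divide lim2) auto
    have "\<forall>\<^sub>F n in sequentially. ?A n \<noteq> 0"
      using lim assms by (intro tendsto_imp_eventually_ne) auto
    then show "\<forall>\<^sub>F n in sequentially.
        (\<Prod>i<k. rGamma_series (1 / of_nat k + of_nat i / of_nat k) n) / ?A n = E n"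
    proof eventually_elim
      case (elim n)
      then show ?case
        using step[of "1 / of_nat k" n] assms by simp
    qed
  qed
  from tendsto_mult[OF lim1[of z] this] have
    "(\<lambda>n. \<Prod>i<k. rGamma_series (z + of_nat i / of_nat k) n)
      \<longlonglongrightarrow> rGamma (of_nat k * z) * exp (of_nat k * z * of_real (ln (real k))) * (P / of_nat k)"
    by (simp only: step)
  from LIMSEQ_unique[OF lim2 this] have "(\<Prod>i<k. rGamma (z + of_nat i / of_nat k)) = 
      rGamma (of_nat k * z) * exp (of_nat k * z * of_real (ln (real k))) * (P / of_nat k)" .
  moreover have "P / of_nat k = of_real ((2 * pi) powr ((1 - real k) / 2) * real k powr (- 1 / 2))"
  proof -
    have sqrt: "sqrt (real k) / real k = real k powr (- 1 / 2)"
      using assms by (simp add: powr_minus powr_half_sqrt field_simps)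
    have "P / of_nat k = of_real ((2 * pi) powr ((1 - real k) / 2) * (sqrt (real k) / real k))"
      by (simp add: P)
    then show ?thesis by (simp only: sqrt)
  qed
  ultimately show ?thesis by (simp add: mult_ac)
qed

subsection \<open>Bounds for the Gamma function on vertical lines\<close>

lemma Complex_add_of_nat: "Complex x t + of_nat j = Complex (x + real j) t"
  by (simp add: complex_eq_iff)

text \<open>The j-th factor of |rGamma(s + i t)| / rGamma(s) is sqrt(1 + t^2 / (s + j)^2), which
  decreases in s. The inequality is written without division, and the normalizing factors of the
  partial products are the same on both sides.\<close>

lemma norm_rGamma_ratio_mono:
  assumes "0 < a" "a \<le> b"
  shows "norm (rGamma (Complex b t)) * rGamma a \<le> norm (rGamma (Complex a t)) * rGamma b"
proof (rule LIMSEQ_le)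
  have norm_series: "norm (rGamma_series (Complex x t) m) =
      (\<Prod>j=0..m. norm (Complex (x + real j) t)) / (fact m * exp (x * ln (real m)))" for x m
    unfolding rGamma_series_def norm_divide norm_mult pochhammer_prod prod_norm[symmetric]
    by (simp add: atLeastLessThanSuc_atLeastAtMost) (simp add: Complex_add_of_nat)
  have series: "rGamma_series x m = (\<Prod>j=0..m. x + real j) / (fact m * exp (x * ln (real m)))" for x m
    by (simp add: rGamma_series_def pochhammer_prod atLeastLessThanSuc_atLeastAtMost)
  have "norm (Complex (b + real j) t) * (a + real j) \<le> norm (Complex (a + real j) t) * (b + real j)" for j
  proof (rule power2_le_imp_le)
    have "(a + real j)\<^sup>2 * t\<^sup>2 \<le> (b + real j)\<^sup>2 * t\<^sup>2"
      using assms by (intro mult_right_mono power_mono) auto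
    then show "(norm (Complex (b + real j) t) * (a + real j))\<^sup>2 \<le> (norm (Complex (a + real j) t) * (b + real j))\<^sup>2"
      unfolding power_mult_distrib by (simp add: complex_norm distrib_right) (simp add: mult.commute)
  qed (use assms in auto)
  then have prod_le: "(\<Prod>j=0..m. norm (Complex (b + real j) t)) * (\<Prod>j=0..m. a + real j)
      \<le> (\<Prod>j=0..m. norm (Complex (a + real j) t)) * (\<Prod>j=0..m. b + real j)" for m :: nat
    unfolding prod.distrib[symmetric] using assms by (intro prod_mono) auto
  show "\<exists>N. \<forall>m\<ge>N. norm (rGamma_series (Complex b t) m) * rGamma_series a m
      \<le> norm (rGamma_series (Complex a t) m) * rGamma_series b m"
    unfolding norm_series series times_divide_times_eq
    using prod_le by (auto intro!: divide_right_mono simp: mult_ac)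
qed (intro tendsto_intros)+

text \<open>On Re z = 1/2 the map z -> 1 - z is complex conjugation, so the reflection formula gives
  the modulus exactly.\<close>

lemma norm_rGamma_half: "norm (rGamma (Complex (1 / 2) t)) = sqrt (cosh (pi * t) / pi)"
proof -
  let ?z = "Complex (1 / 2) t"
  have "1 - ?z = cnj ?z" by (simp add: complex_eq_iff)
  then have "of_real ((norm (rGamma ?z))\<^sup>2) = rGamma ?z * rGamma (1 - ?z)"
    by (simp only: complex_norm_square cnj_rGamma)
  also have "\<dots> = sin (of_real pi * ?z) / of_real pi"
    by (rule rGamma_reflection_complex)
  also have "of_real pi * ?z = of_real (pi / 2) - (- \<i> * of_real (pi * t))"
    by (simp add: complex_eq_iff)
  also have "sin \<dots> = cos (\<i> * of_real (pi * t))"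
    by (simp add: sin_cos_eq)
  also have "\<dots> = of_real (cosh (pi * t))"
    by (simp add: cosh_conv_cos[symmetric] cosh_field_def flip: exp_of_real)
  finally have "(norm (rGamma ?z))\<^sup>2 = cosh (pi * t) / pi"
    by (simp only: of_real_eq_iff flip: of_real_divide)
  then show ?thesis by (metis norm_ge_zero real_sqrt_unique)
qed

lemma cosh_le_exp_abs: "cosh (x :: real) \<le> exp \<bar>x\<bar>"
  and exp_abs_le_cosh: "exp \<bar>x\<bar> \<le> 2 * cosh (x :: real)"
  by (auto simp: cosh_def abs_if)

lemma norm_rGamma_le:
  assumes "s \<ge> 1 / 2"
  shows "norm (rGamma (Complex s t)) \<le> exp (pi / 2 * \<bar>t\<bar>) * rGamma s"
proof -
  have pos: "rGamma s > 0"
    using assms by (simp add: rGamma_inverse_Gamma Gamma_real_pos)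
  have half: "rGamma (1 / 2 :: real) = 1 / sqrt pi"
    by (simp add: rGamma_inverse_Gamma Gamma_one_half_real inverse_eq_divide)
  have "norm (rGamma (Complex s t)) * rGamma (1 / 2) \<le> sqrt (cosh (pi * t) / pi) * rGamma s"
    using norm_rGamma_ratio_mono[of "1 / 2" s t] assms by (simp add: norm_rGamma_half)
  then have "norm (rGamma (Complex s t)) \<le> sqrt (cosh (pi * t)) * rGamma s"
    unfolding half by (simp add: real_sqrt_divide field_simps)
  also have "sqrt (cosh (pi * t)) \<le> sqrt ((exp (pi / 2 * \<bar>t\<bar>))\<^sup>2)"
    using cosh_le_exp_abs[of "pi * t"] by (simp add: abs_mult flip: exp_of_nat_mult)
  finally show ?thesis using pos by (simp add: mult_right_mono)
qed

lemma norm_pochhammer_le: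
  fixes z :: "'a :: real_normed_field"
  shows "norm (pochhammer z m) \<le> pochhammer (norm z) m"
  unfolding pochhammer_prod prod_norm[symmetric]
  by (intro prod_mono) (auto intro: order_trans[OF norm_triangle_ineq])

lemma pochhammer_mono_real:
  fixes x y :: real
  assumes "0 \<le> x" "x \<le> y"
  shows "pochhammer x m \<le> pochhammer y m"
  unfolding pochhammer_prod using assms by (intro prod_mono) auto

text \<open>A single term of the binomial series of \<open>(1 - w)\<^sup>-\<^sup>x\<close> at \<open>w = 1 - e\<^sup>-\<^sup>\<eta>\<close> is at most the whole sum.\<close>

lemma pochhammer_le_exp:
  fixes x \<eta> :: real
  assumes "x \<ge> 0" "\<eta> > 0"
  shows "pochhammer x m \<le> fact m / (1 - exp (- \<eta>)) ^ m * exp (\<eta> * x)"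
proof -
  define w where "w = 1 - exp (- \<eta>)"
  have w: "0 < w" "w < 1" using assms by (auto simp: w_def)
  have "(\<lambda>j. (- x gchoose j) * (- w) ^ j) sums (1 + (- w)) powr (- x)"
    using w by (intro gen_binomial_real) auto
  moreover have "(- x gchoose j) * (- w) ^ j = pochhammer x j / fact j * w ^ j" for j
    by (simp add: gbinomial_pochhammer power_mult_distrib[of "-1" w, simplified] flip: power_add)
  moreover have "(1 + (- w)) powr (- x) = exp (\<eta> * x)"
    by (simp add: w_def powr_def)
  ultimately have S: "(\<lambda>j. pochhammer x j / fact j * w ^ j) sums exp (\<eta> * x)"
    by simp
  have "(\<Sum>j\<in>{m}. pochhammer x j / fact j * w ^ j) \<le> exp (\<eta> * x)"
    unfolding sums_unique[OF S]
    using S w assms by (intro sum_le_suminf) (auto simp: sums_iff pochhammer_prod intro!: prod_nonneg mult_nonneg_nonneg divide_nonneg_nonneg)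
  then show ?thesis using w by (simp add: w_def[symmetric] field_simps)
qed

lemma norm_Gamma_half_integer_le:
  assumes "\<eta> > 0"
  shows "norm (Gamma (Complex (real m + 1 / 2) t)) \<le>
           sqrt (2 * pi) * exp \<eta> * (fact m / (1 - exp (- \<eta>)) ^ m) * exp ((\<eta> - pi / 2) * \<bar>t\<bar>)"
proof -
  let ?z = "Complex (1 / 2) t"
  have "?z \<notin> \<int>\<^sub>\<le>\<^sub>0" by (auto elim!: nonpos_Ints_cases simp: complex_eq_iff)
  then have "Gamma ?z \<noteq> 0" by (simp add: Gamma_eq_zero_iff)
  have "Complex (real m + 1 / 2) t = ?z + of_nat m" by (simp add: complex_eq_iff)
  with pochhammer_Gamma[OF \<open>?z \<notin> \<int>\<^sub>\<le>\<^sub>0\<close>, of m] \<open>Gamma ?z \<noteq> 0\<close>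
  have "norm (Gamma (Complex (real m + 1 / 2) t)) = norm (pochhammer ?z m) * norm (Gamma ?z)"
    by (simp add: field_simps flip: norm_mult)
  moreover have "norm (pochhammer ?z m) \<le> fact m / (1 - exp (- \<eta>)) ^ m * exp (\<eta> * (\<bar>t\<bar> + 1))"
  proof -
    have "norm (pochhammer ?z m) \<le> pochhammer (\<bar>t\<bar> + 1) m"
      using order_trans[OF norm_pochhammer_le[of ?z m] pochhammer_mono_real[of "norm ?z" "\<bar>t\<bar> + 1" m]]
        cmod_le[of ?z] by simp
    also have "\<dots> \<le> fact m / (1 - exp (- \<eta>)) ^ m * exp (\<eta> * (\<bar>t\<bar> + 1))"
      using assms by (intro pochhammer_le_exp) auto
    finally show ?thesis .
  qed
  moreover have "norm (Gamma ?z) \<le> sqrt (2 * pi) * exp (- (pi / 2) * \<bar>t\<bar>)"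
  proof -
    have "norm (Gamma ?z) = sqrt (pi / cosh (pi * t))"
      using norm_rGamma_half[of t] by (simp add: Gamma_def norm_inverse real_sqrt_divide)
    also have "\<dots> \<le> sqrt (pi * (2 * exp (- (pi * \<bar>t\<bar>))))"
    proof -
      have "1 / cosh (pi * t) \<le> 2 * exp (- (pi * \<bar>t\<bar>))"
        using exp_abs_le_cosh[of "pi * t"] cosh_real_pos[of "pi * t"]
        by (simp add: abs_mult exp_minus field_simps)
      from mult_left_mono[OF this, of pi] show ?thesis by simp
    qed
    also have "\<dots> = sqrt (2 * pi * (exp (- (pi / 2) * \<bar>t\<bar>))\<^sup>2)"
      by (simp add: power2_eq_square flip: exp_add)
    also have "\<dots> = sqrt (2 * pi) * exp (- (pi / 2) * \<bar>t\<bar>)"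
      by (simp only: real_sqrt_mult real_sqrt_abs abs_exp_cancel)
    finally show ?thesis .
  qed
  ultimately have "norm (Gamma (Complex (real m + 1 / 2) t)) \<le> fact m / (1 - exp (- \<eta>)) ^ m *
      exp (\<eta> * (\<bar>t\<bar> + 1)) * (sqrt (2 * pi) * exp (- (pi / 2) * \<bar>t\<bar>))"
    using assms by (simp only:) (intro mult_mono, auto)
  also have "\<dots> = sqrt (2 * pi) * exp \<eta> * (fact m / (1 - exp (- \<eta>)) ^ m) * exp ((\<eta> - pi / 2) * \<bar>t\<bar>)"
  proof -
    have "(\<eta> - pi / 2) * \<bar>t\<bar> = \<eta> * \<bar>t\<bar> + - (pi / 2) * \<bar>t\<bar>"
      by (simp only: diff_conv_add_uminus distrib_right)
    moreover have "\<eta> * (\<bar>t\<bar> + 1) = \<eta> * \<bar>t\<bar> + \<eta>"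
      by (simp only: distrib_left mult_1_right)
    ultimately show ?thesis by (simp only: exp_add mult_ac)
  qed
  finally show ?thesis .
qed

text \<open>By \<open>norm_rGamma_ratio_mono\<close> an upper bound for Gamma is inherited from any
  line further to the right. The half-integer line \<open>e\<close> beyond b provides one that is
  uniform over the strip.\<close>

lemma Gamma_vertical_bound:
  assumes "\<eta> > 0" "0 < a"
  obtains A where "A > 0"
    "\<And>s t. s \<in> {a..b} \<Longrightarrow> norm (Gamma (Complex s t)) \<le> A * exp ((\<eta> - pi / 2) * \<bar>t\<bar>)"
proof -
  obtain m where m: "b \<le> real m" using real_arch_simple by blast
  define e where "e = real m + 1 / 2"
  have "e > 0" by (simp add: e_def)
  have "compact (Gamma ` {a..b})"
    using assms by (intro compact_continuous_image continuous_intros)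
      (auto elim!: nonpos_Ints_cases)
  then have "bounded (Gamma ` {a..b})" by (rule compact_imp_bounded)
  then obtain C where "\<forall>x\<in>Gamma ` {a..b}. norm x \<le> C"
    unfolding bounded_iff by (elim exE)
  then have C: "norm (Gamma s) \<le> C" if "s \<in> {a..b}" for s
    using that by blast
  define D where "D = sqrt (2 * pi) * exp \<eta> * (fact m / (1 - exp (- \<eta>)) ^ m)"
  have "D > 0" using assms by (simp add: D_def)
  have "norm (Gamma (Complex s t)) \<le> (max C 1 * rGamma e * D) * exp ((\<eta> - pi / 2) * \<bar>t\<bar>)"
    if s: "s \<in> {a..b}" for s t
  proof -
    have pos: "Gamma s > 0" "Gamma e > 0"
      using s assms \<open>e > 0\<close> by (auto intro: Gamma_real_pos)
    have "Complex x t \<notin> \<int>\<^sub>\<le>\<^sub>0" if "x > 0" for x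
      using that by (auto elim!: nonpos_Ints_cases simp: complex_eq_iff)
    then have nz: "rGamma (Complex s t) \<noteq> 0" "rGamma (Complex e t) \<noteq> 0"
      using s assms \<open>e > 0\<close> by (auto simp: rGamma_eq_zero_iff)
    have "norm (rGamma (Complex e t)) * rGamma s \<le> norm (rGamma (Complex s t)) * rGamma e"
      using s m assms by (intro norm_rGamma_ratio_mono) (auto simp: e_def)
    then have "norm (Gamma (Complex s t)) \<le> Gamma s * rGamma e * norm (Gamma (Complex e t))"
      using nz pos unfolding Gamma_def norm_inverse by (simp add: field_simps)
    also have "\<dots> \<le> max C 1 * rGamma e * (D * exp ((\<eta> - pi / 2) * \<bar>t\<bar>))"
      using C[OF s] pos norm_Gamma_half_integer_le[OF \<open>\<eta> > 0\<close>, of m t]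
      by (intro mult_mono) (auto simp: D_def e_def rGamma_inverse_Gamma)
    finally show ?thesis by (simp add: mult_ac)
  qed
  moreover have "max C 1 * rGamma e * D > 0"
    using \<open>D > 0\<close> \<open>e > 0\<close> by (auto simp: rGamma_inverse_Gamma Gamma_real_pos)
  ultimately show ?thesis using that by blast
qed

text \<open>The strip may contain poles of Gamma. Shifting it by m into Re >= 1/2 makes
  \<open>norm_rGamma_le\<close> applicable, and the rising factorial from the recurrence is absorbed
  into exp(\<eta> |t|).\<close>

lemma rGamma_vertical_bound:
  assumes "\<eta> > 0"
  obtains A where "A > 0"
    "\<And>s t. s \<in> {a..b} \<Longrightarrow> norm (rGamma (Complex s t)) \<le> A * exp ((\<eta> + pi / 2) * \<bar>t\<bar>)"
proof -
  obtain m where m: "1 / 2 - a \<le> real m" using real_arch_simple by blast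
  have "compact ((\<lambda>s. rGamma (s + real m)) ` {a..b})"
    by (intro compact_continuous_image continuous_on_compose2[OF continuous_on_rGamma[of UNIV]] continuous_intros) auto
  then have "bounded ((\<lambda>s. rGamma (s + real m)) ` {a..b})" by (rule compact_imp_bounded)
  then obtain C where "\<forall>x\<in>(\<lambda>s. rGamma (s + real m)) ` {a..b}. norm x \<le> C"
    unfolding bounded_iff by (elim exE)
  then have C: "norm (rGamma (s + real m)) \<le> C" if "s \<in> {a..b}" for s
    using that by blast
  define D where "D = fact m / (1 - exp (- \<eta>)) ^ m * exp (\<eta> * (\<bar>a\<bar> + \<bar>b\<bar>))"
  have "D > 0" using assms by (simp add: D_def)
  have "norm (rGamma (Complex s t)) \<le> (D * max C 1) * exp ((\<eta> + pi / 2) * \<bar>t\<bar>)"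
    if s: "s \<in> {a..b}" for s t
  proof -
    have "Complex (s + real m) t = Complex s t + of_nat m" by (simp add: complex_eq_iff)
    then have "norm (rGamma (Complex s t)) = norm (pochhammer (Complex s t) m) * norm (rGamma (Complex (s + real m) t))"
      by (simp add: pochhammer_rGamma[of "Complex s t" m] norm_mult)
    moreover have "norm (pochhammer (Complex s t) m) \<le> D * exp (\<eta> * \<bar>t\<bar>)"
    proof -
      have "norm (pochhammer (Complex s t) m) \<le> pochhammer (norm (Complex s t)) m"
        by (rule norm_pochhammer_le)
      also have "\<dots> \<le> pochhammer (\<bar>a\<bar> + \<bar>b\<bar> + \<bar>t\<bar>) m"
        using cmod_le[of "Complex s t"] s by (intro pochhammer_mono_real) auto
      also have "\<dots> \<le> fact m / (1 - exp (- \<eta>)) ^ m * exp (\<eta> * (\<bar>a\<bar> + \<bar>b\<bar> + \<bar>t\<bar>))"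
        using assms by (intro pochhammer_le_exp) auto
      also have "\<dots> = D * exp (\<eta> * \<bar>t\<bar>)"
        by (simp add: D_def distrib_left exp_add)
      finally show ?thesis .
    qed
    moreover have "norm (rGamma (Complex (s + real m) t)) \<le> exp (pi / 2 * \<bar>t\<bar>) * max C 1"
    proof -
      have "norm (rGamma (Complex (s + real m) t)) \<le> exp (pi / 2 * \<bar>t\<bar>) * rGamma (s + real m)"
        using s m by (intro norm_rGamma_le) auto
      also have "\<dots> \<le> exp (pi / 2 * \<bar>t\<bar>) * max C 1"
        using C[OF s] by (intro mult_left_mono) auto
      finally show ?thesis .
    qed
    ultimately have "norm (rGamma (Complex s t)) \<le> D * exp (\<eta> * \<bar>t\<bar>) * (exp (pi / 2 * \<bar>t\<bar>) * max C 1)"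
      using \<open>D > 0\<close> by (simp only:) (intro mult_mono, auto)
    also have "\<dots> = (D * max C 1) * (exp (\<eta> * \<bar>t\<bar>) * exp (pi / 2 * \<bar>t\<bar>))"
      by simp
    also have "exp (\<eta> * \<bar>t\<bar>) * exp (pi / 2 * \<bar>t\<bar>) = exp ((\<eta> + pi / 2) * \<bar>t\<bar>)"
      by (simp only: distrib_right exp_add)
    finally show ?thesis .
  qed
  moreover have "D * max C 1 > 0" using \<open>D > 0\<close> by auto
  ultimately show ?thesis using that by blast
qed

text \<open>Keep only the interval from B to B + 1 in Euler's integral for Gamma(s). As B is
  arbitrary, 1 / Gamma decays faster than every geometric sequence.\<close>

lemma rGamma_le_powr:
  fixes B s :: real
  assumes "B > 0" "s \<ge> 1"
  shows "rGamma s \<le> exp (B + 1) * B powr (1 - s)"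
proof -
  have "((\<lambda>t. t powr (s - 1) / exp t) has_integral Gamma s) {0..}"
    using assms by (intro Gamma_integral_real) auto
  moreover have "((\<lambda>t. B powr (s - 1) / exp (B + 1)) has_integral (B powr (s - 1) / exp (B + 1))) {B..B + 1}"
    using has_integral_const_real[of "B powr (s - 1) / exp (B + 1)" B "B + 1"] by simp
  then have "((\<lambda>t. if t \<in> {B..B + 1} then B powr (s - 1) / exp (B + 1) else 0)
      has_integral (B powr (s - 1) / exp (B + 1))) {0..}"
    using assms by (subst has_integral_restrict) auto
  ultimately have "B powr (s - 1) / exp (B + 1) \<le> Gamma s"
    using assms by (elim has_integral_le[rotated]) (auto intro!: frac_le powr_mono2)
  then show ?thesis
    using assms Gamma_real_pos[of s] 
    by (simp add: rGamma_inverse_Gamma powr_diff field_simps)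
qed

subsection \<open>Integrals along vertical lines\<close>

lemma integrable_exp_neg_abs:
  fixes \<delta> :: real
  assumes "\<delta> > 0"
  shows "integrable lborel (\<lambda>t. exp (- \<delta> * \<bar>t\<bar>))"
proof -
  have "((\<lambda>t. - exp (- \<delta> * t) / \<delta>) \<longlongrightarrow> - exp (- \<delta> * 0) / \<delta>) (at_right 0)"
    using assms by (intro tendsto_intros) auto
  then have at_0: "(((\<lambda>t. - exp (- \<delta> * t) / \<delta>) \<circ> real_of_ereal) \<longlongrightarrow> - exp (- \<delta> * 0) / \<delta>) (at_right 0)"
    unfolding zero_ereal_def by (simp add: ereal_tendsto_simps1)
  have "filterlim (\<lambda>t. - \<delta> * t) at_bot at_top"
    using assms by (intro filterlim_tendsto_neg_mult_at_bot[OF tendsto_const _ filterlim_ident]) auto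
  then have "((\<lambda>t. - exp (- \<delta> * t) / \<delta>) \<longlongrightarrow> - 0 / \<delta>) at_top"
    using assms by (intro tendsto_intros filterlim_compose[OF exp_at_bot]) auto
  then have at_inf: "(((\<lambda>t. - exp (- \<delta> * t) / \<delta>) \<circ> real_of_ereal) \<longlongrightarrow> - 0 / \<delta>) (at_left \<infinity>)"
    by (simp add: ereal_tendsto_simps1)
  have "set_integrable lborel (einterval 0 \<infinity>) (\<lambda>t. exp (- \<delta> * t))"
    by (rule interval_integral_FTC_nonneg(1)[OF _ _ _ _ at_0 at_inf])
      (use assms in \<open>auto intro!: derivative_eq_intros continuous_intros\<close>)
  moreover have "einterval 0 \<infinity> = {0 :: real<..}"
    by (auto simp: einterval_def)
  ultimately have pos: "set_integrable lborel {0<..} (\<lambda>t. exp (- \<delta> * t))"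
    by simp
  have "set_integrable lborel {0<..} (\<lambda>t. exp (- \<delta> * \<bar>t\<bar>))"
    using pos by (rule set_integrable_cong[THEN iffD1, rotated -1]) auto
  then have i: "integrable lborel (\<lambda>t. indicator {0<..} t *\<^sub>R exp (- \<delta> * \<bar>t\<bar>))"
    by (simp add: set_integrable_def)
  from lborel_integrable_real_affine[OF this, of "-1" 0]
  have "integrable lborel (\<lambda>t. indicator {0<..} (- t) *\<^sub>R exp (- \<delta> * \<bar>t\<bar>))"
    by simp
  from Bochner_Integration.integrable_add[OF i this]
  show ?thesis
  proof (rule integrable_cong_AE_imp)
    show "AE t in lborel. indicator {0<..} t *\<^sub>R exp (- \<delta> * \<bar>t\<bar>) +
        indicator {0<..} (- t) *\<^sub>R exp (- \<delta> * \<bar>t\<bar>) = exp (- \<delta> * \<bar>t\<bar>)"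
      using AE_lborel_singleton[of 0] by eventually_elim (auto simp: indicator_def)
  qed simp
qed

lemma vertical_line_continuous_measurable:
  assumes "continuous_on {u. Re u = c} f"
  shows "(\<lambda>t. f (Complex c t)) \<in> borel_measurable borel"
  by (intro borel_measurable_continuous_onI continuous_on_compose2[OF assms])
     (auto simp: Complex_eq intro!: continuous_intros)

lemma vertical_line_integrable:
  fixes f :: "complex \<Rightarrow> complex"
  assumes "continuous_on {u. Re u = c} f" "\<delta> > 0"
    and "\<And>t. norm (f (Complex c t)) \<le> A * exp (- \<delta> * \<bar>t\<bar>)"
  shows "integrable lborel (\<lambda>t. f (Complex c t))"
proof (rule Bochner_Integration.integrable_bound)
  show "integrable lborel (\<lambda>t. A * exp (- \<delta> * \<bar>t\<bar>))"
    using integrable_exp_neg_abs[OF \<open>\<delta> > 0\<close>] by simp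
  show "AE t in lborel. norm (f (Complex c t)) \<le> norm (A * exp (- \<delta> * \<bar>t\<bar>))"
    using assms(3) by (auto intro: order_trans[OF _ abs_ge_self])
qed (use vertical_line_continuous_measurable[OF assms(1)] in simp)

text \<open>Bridge between the gauge integrals that come from sides of finite rectangles and the
  Lebesgue integral over the whole line.\<close>

lemma tendsto_integral_symmetric_interval:
  fixes f :: "real \<Rightarrow> 'a :: euclidean_space"
  assumes "integrable lborel f"
  shows "(\<lambda>n. integral {- real n..real n} f) \<longlonglongrightarrow> (\<integral>t. f t \<partial>lborel)"
proof -
  have "set_integrable lborel {- real n..real n} f" for n
    using assms by (auto simp: set_integrable_def intro: integrable_mult_indicator)
  then have eq: "integral {- real n..real n} f = (\<integral>t. indicator {- real n..real n} t *\<^sub>R f t \<partial>lborel)" for n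
    by (simp add: set_borel_integral_eq_integral(2)[symmetric] set_lebesgue_integral_def)
  show ?thesis
    unfolding eq
  proof (rule integral_dominated_convergence)
    show "integrable lborel (\<lambda>t. norm (f t))" using assms by simp
    show "AE t in lborel. (\<lambda>n. indicator {- real n..real n} t *\<^sub>R f t) \<longlonglongrightarrow> f t"
    proof (rule AE_I2)
      fix t :: real
      have "\<forall>\<^sub>F n in sequentially. \<bar>t\<bar> \<le> real n"
        using filterlim_real_sequentially by (simp add: filterlim_at_top)
      then show "(\<lambda>n. indicator {- real n..real n} t *\<^sub>R f t) \<longlonglongrightarrow> f t"
        by (intro tendsto_eventually) (elim eventually_mono, auto simp: indicator_def)
    qed
  qed (use assms in \<open>auto split: split_indicator\<close>)
qed

section \<open>Cauchy's formula and contour shift in an infinite vertical strip\<close>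

lemma continuous_on_div_sub:
  assumes "g holomorphic_on S" "{u. Re u = c} \<subseteq> S" "c \<noteq> r"
  shows "continuous_on {u. Re u = c} (\<lambda>u. g u / (u - of_real r))"
  using assms
  by (intro continuous_intros continuous_on_subset[OF holomorphic_on_imp_continuous_on[OF assms(1)]]) auto

text \<open>Cauchy's integral formula for the rectangle with corners \<open>c\<^sub>1 \<plusminus> \<i> n\<close>, \<open>c\<^sub>2 \<plusminus> \<i> n\<close>, as \<open>n\<close>
  tends to infinity.\<close>

lemma Cauchy_integral_formula_strip:
  fixes g :: "complex \<Rightarrow> complex"
  assumes hol: "g holomorphic_on {u. Re u > a}" and ord: "a < c\<^sub>1" "c\<^sub>1 < r" "r < c\<^sub>2"
    and \<delta>: "\<delta> > 0" and bound: "\<And>c t. c \<in> {c\<^sub>1..c\<^sub>2} \<Longrightarrow> norm (g (Complex c t)) \<le> A * exp (- \<delta> * \<bar>t\<bar>)"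
  shows "c \<in> {c\<^sub>1, c\<^sub>2} \<Longrightarrow> integrable lborel (\<lambda>t. g (Complex c t) / (Complex c t - of_real r))"
    and "(\<integral>t. g (Complex c\<^sub>2 t) / (Complex c\<^sub>2 t - of_real r) \<partial>lborel) -
         (\<integral>t. g (Complex c\<^sub>1 t) / (Complex c\<^sub>1 t - of_real r) \<partial>lborel) = 2 * pi * g (of_real r)"
proof -
  let ?h = "\<lambda>u. g u / (u - of_real r)"
  have int: "integrable lborel (\<lambda>t. ?h (Complex c t))" if c: "c \<in> {c\<^sub>1, c\<^sub>2}" for c
  proof (rule vertical_line_integrable)
    show "continuous_on {u. Re u = c} ?h"
      using c ord by (intro continuous_on_div_sub[OF hol]) auto
    show "norm (?h (Complex c t)) \<le> A / \<bar>c - r\<bar> * exp (- \<delta> * \<bar>t\<bar>)" for t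
    proof -
      have "\<bar>c - r\<bar> \<le> norm (Complex c t - of_real r)"
        using abs_Re_le_cmod[of "Complex c t - of_real r"] by simp
      moreover have "norm (g (Complex c t)) \<le> A * exp (- \<delta> * \<bar>t\<bar>)"
        using c ord by (intro bound) auto
      ultimately have "norm (?h (Complex c t)) \<le> A * exp (- \<delta> * \<bar>t\<bar>) / \<bar>c - r\<bar>"
        using c ord unfolding norm_divide
        by (intro frac_le order_trans[OF norm_ge_zero]) auto
      then show ?thesis by simp
    qed
  qed (fact \<delta>)
  then show "c \<in> {c\<^sub>1, c\<^sub>2} \<Longrightarrow> integrable lborel (\<lambda>t. ?h (Complex c t))" .
  have A: "A \<ge> 0"
    using order_trans[OF norm_ge_zero bound[of c\<^sub>1 0]] ord by simp
  have lim: "(\<lambda>n. integral {- real n..real n} (\<lambda>t. ?h (Complex c t))) \<longlonglongrightarrow> (\<integral>t. ?h (Complex c t) \<partial>lborel)"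
    if "c \<in> {c\<^sub>1, c\<^sub>2}" for c
    by (intro tendsto_integral_symmetric_interval int that)
  have "(\<lambda>n. \<i> * integral {- real n..real n} (\<lambda>t. ?h (Complex c\<^sub>2 t))
       - \<i> * integral {- real n..real n} (\<lambda>t. ?h (Complex c\<^sub>1 t)) - 2 * pi * \<i> * g (of_real r)) \<longlonglongrightarrow> 0"
  proof (rule Lim_null_comparison)
    show "\<forall>\<^sub>F n in sequentially. norm (\<i> * integral {- real n..real n} (\<lambda>t. ?h (Complex c\<^sub>2 t))
       - \<i> * integral {- real n..real n} (\<lambda>t. ?h (Complex c\<^sub>1 t)) - 2 * pi * \<i> * g (of_real r))
       \<le> 2 * A * (c\<^sub>2 - c\<^sub>1) * inverse (real n)"
      using eventually_gt_at_top[of 0]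
    proof eventually_elim
      fix n :: nat assume n: "n > 0"
      define p1 p2 p3 p4 where "p1 = Complex c\<^sub>1 (- real n)" and "p2 = Complex c\<^sub>2 (- real n)"
        and "p3 = Complex c\<^sub>2 (real n)" and "p4 = Complex c\<^sub>1 (real n)"
      have rect: "rectpath p1 p3 = linepath p1 p2 +++ linepath p2 p3 +++ linepath p3 p4 +++ linepath p4 p1"
        by (simp add: rectpath_def Let_def p1_def p2_def p3_def p4_def)
      have "(?h has_contour_integral (2 * pi * \<i> * winding_number (rectpath p1 p3) r * g r)) (rectpath p1 p3)"
      proof (rule Cauchy_integral_formula_convex_simple[OF _ hol])
        show "convex {u. Re u > a}" by (rule convex_halfspace_Re_gt)
        show "of_real r \<in> interior {u. Re u > a}"
          using ord by (simp add: interior_open open_halfspace_Re_gt)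
        show "path_image (rectpath p1 p3) \<subseteq> {u. Re u > a} - {of_real r}"
          using ord n by (auto simp: path_image_rectpath p1_def p3_def)
      qed auto
      moreover have "winding_number (rectpath p1 p3) r = 1"
        using ord n by (intro winding_number_rectpath) (auto simp: in_box_complex_iff p1_def p3_def)
      ultimately have "(?h has_contour_integral (2 * pi * \<i> * g r)) (rectpath p1 p3)"
        by simp
      then have Cauchy: "contour_integral (rectpath p1 p3) ?h = 2 * pi * \<i> * g r"
        by (rule contour_integral_unique)
      have cont: "continuous_on (closed_segment p q) ?h"
        if "closed_segment p q \<subseteq> {u. Re u > a} - {of_real r}" for p q
        using that by (intro continuous_intros continuous_on_subset[OF holomorphic_on_imp_continuous_on[OF hol]]) auto
      have seg: "closed_segment p1 p2 \<subseteq> {u. Re u > a} - {of_real r}"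
        "closed_segment p2 p3 \<subseteq> {u. Re u > a} - {of_real r}"
        "closed_segment p3 p4 \<subseteq> {u. Re u > a} - {of_real r}"
        "closed_segment p4 p1 \<subseteq> {u. Re u > a} - {of_real r}"
        using ord n by (auto simp: p1_def p2_def p3_def p4_def closed_segment_same_Re closed_segment_same_Im
            closed_segment_eq_real_ivl split: if_splits)
      note integ = contour_integrable_continuous_linepath[OF cont[OF seg(1)]]
        contour_integrable_continuous_linepath[OF cont[OF seg(2)]]
        contour_integrable_continuous_linepath[OF cont[OF seg(3)]]
        contour_integrable_continuous_linepath[OF cont[OF seg(4)]]
      have split: "contour_integral (rectpath p1 p3) ?h =
          contour_integral (linepath p1 p2) ?h + (contour_integral (linepath p2 p3) ?h +
          (contour_integral (linepath p3 p4) ?h + contour_integral (linepath p4 p1) ?h))"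
        unfolding rect using integ by (simp add: contour_integrable_joinI)
      have vert: "contour_integral (linepath (Complex c (- real n)) (Complex c (real n))) ?h
          = \<i> * integral {- real n..real n} (\<lambda>t. ?h (Complex c t))"
        if "?h contour_integrable_on linepath (Complex c (- real n)) (Complex c (real n))" for c
      proof -
        have "(?h has_contour_integral contour_integral (linepath (Complex c (- real n)) (Complex c (real n))) ?h)
            (linepath (Complex c (- real n)) (Complex c (real n)))"
          using that by (rule has_contour_integral_integral)
        then have "((\<lambda>t. ?h (Complex c t)) has_integral
           (- \<i> * contour_integral (linepath (Complex c (- real n)) (Complex c (real n))) ?h)) {- real n..real n}"
          using n by (subst (asm) has_contour_integral_linepath_same_Re_iff) auto
        then show ?thesis by (simp add: integral_unique)
      qed
      have right: "contour_integral (linepath p2 p3) ?h = \<i> * integral {- real n..real n} (\<lambda>t. ?h (Complex c\<^sub>2 t))"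
        using integ(2) unfolding p2_def p3_def by (rule vert)
      have "contour_integral (linepath p4 p1) ?h = - contour_integral (linepath p1 p4) ?h"
        by (rule contour_integral_reverse_linepath) (use cont[OF seg(4)] in \<open>simp add: closed_segment_commute\<close>)
      moreover have "contour_integral (linepath p1 p4) ?h = \<i> * integral {- real n..real n} (\<lambda>t. ?h (Complex c\<^sub>1 t))"
        unfolding p1_def p4_def
        by (rule vert) (use contour_integrable_continuous_linepath[of p1 p4 ?h] cont[of p1 p4] seg(4) in
          \<open>simp add: closed_segment_commute p1_def p4_def\<close>)
      ultimately have left: "contour_integral (linepath p4 p1) ?h = - (\<i> * integral {- real n..real n} (\<lambda>t. ?h (Complex c\<^sub>1 t)))"
        by simp
      \<comment> \<open>On a horizontal side |g| <= A and |u - r| >= n, while the length stays c2 -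
        c1, so its contribution is O(1/n).\<close>
      have hor: "norm (contour_integral (linepath p q) ?h) \<le> A / real n * (c\<^sub>2 - c\<^sub>1)"
        if pq: "?h contour_integrable_on linepath p q" "norm (q - p) = c\<^sub>2 - c\<^sub>1"
          "closed_segment p q \<subseteq> {u. Re u \<in> {c\<^sub>1..c\<^sub>2} \<and> \<bar>Im u\<bar> = real n}" for p q
        unfolding pq(2)[symmetric]
      proof (rule contour_integral_bound_linepath[OF pq(1)])
        fix u assume "u \<in> closed_segment p q"
        with pq(3) have u: "Re u \<in> {c\<^sub>1..c\<^sub>2}" "\<bar>Im u\<bar> = real n" by auto
        have "norm (g u) \<le> A * exp (- \<delta> * \<bar>Im u\<bar>)"
          using bound[OF u(1), of "Im u"] by (simp only: complex_surj)
        also have "\<dots> \<le> A * 1"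
          using A \<delta> by (intro mult_left_mono) auto
        finally have "norm (g u) \<le> A" by simp
        moreover have "real n \<le> norm (u - of_real r)"
          using abs_Im_le_cmod[of "u - of_real r"] u by simp
        ultimately show "norm (?h u) \<le> A / real n"
          unfolding norm_divide using n A by (intro frac_le) auto
      qed (use A in auto)
      have "p2 - p1 = of_real (c\<^sub>2 - c\<^sub>1)" "p4 - p3 = of_real (c\<^sub>1 - c\<^sub>2)"
        by (auto simp: p1_def p2_def p3_def p4_def complex_eq_iff)
      then have width: "norm (p2 - p1) = c\<^sub>2 - c\<^sub>1" "norm (p4 - p3) = c\<^sub>2 - c\<^sub>1"
        using ord by (simp_all only: norm_of_real)
      have b1: "norm (contour_integral (linepath p1 p2) ?h) \<le> A / real n * (c\<^sub>2 - c\<^sub>1)"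
        using ord by (intro hor[OF integ(1) width(1)])
          (auto simp: p1_def p2_def closed_segment_same_Im closed_segment_eq_real_ivl)
      have b2: "norm (contour_integral (linepath p3 p4) ?h) \<le> A / real n * (c\<^sub>2 - c\<^sub>1)"
        using ord by (intro hor[OF integ(3) width(2)])
          (auto simp: p3_def p4_def closed_segment_same_Im closed_segment_eq_real_ivl)
      have eq: "\<i> * integral {- real n..real n} (\<lambda>t. ?h (Complex c\<^sub>2 t))
         - \<i> * integral {- real n..real n} (\<lambda>t. ?h (Complex c\<^sub>1 t)) - 2 * pi * \<i> * g (of_real r) =
         - (contour_integral (linepath p1 p2) ?h + contour_integral (linepath p3 p4) ?h)"
        using Cauchy unfolding split right left by (simp add: algebra_simps)
      have two: "2 * A * (c\<^sub>2 - c\<^sub>1) * inverse (real n) = A / real n * (c\<^sub>2 - c\<^sub>1) + A / real n * (c\<^sub>2 - c\<^sub>1)"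
        by (simp add: divide_inverse)
      show "norm (\<i> * integral {- real n..real n} (\<lambda>t. ?h (Complex c\<^sub>2 t))
         - \<i> * integral {- real n..real n} (\<lambda>t. ?h (Complex c\<^sub>1 t)) - 2 * pi * \<i> * g (of_real r))
         \<le> 2 * A * (c\<^sub>2 - c\<^sub>1) * inverse (real n)"
        unfolding eq norm_minus_cancel two by (rule order_trans[OF norm_triangle_ineq add_mono[OF b1 b2]])
    qed
    show "(\<lambda>n. 2 * A * (c\<^sub>2 - c\<^sub>1) * inverse (real n)) \<longlonglongrightarrow> 0"
      by (rule tendsto_mult_right_zero[OF lim_inverse_n])
  qed
  moreover have "(\<lambda>n. \<i> * integral {- real n..real n} (\<lambda>t. ?h (Complex c\<^sub>2 t))
       - \<i> * integral {- real n..real n} (\<lambda>t. ?h (Complex c\<^sub>1 t)) - 2 * pi * \<i> * g (of_real r))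
       \<longlonglongrightarrow> \<i> * (\<integral>t. ?h (Complex c\<^sub>2 t) \<partial>lborel) - \<i> * (\<integral>t. ?h (Complex c\<^sub>1 t) \<partial>lborel)
       - 2 * pi * \<i> * g (of_real r)"
    by (intro tendsto_intros lim) auto
  ultimately have "\<i> * (\<integral>t. ?h (Complex c\<^sub>2 t) \<partial>lborel) - \<i> * (\<integral>t. ?h (Complex c\<^sub>1 t) \<partial>lborel)
       - 2 * pi * \<i> * g (of_real r) = 0"
    using LIMSEQ_unique by blast
  then have "\<i> * ((\<integral>t. ?h (Complex c\<^sub>2 t) \<partial>lborel) - (\<integral>t. ?h (Complex c\<^sub>1 t) \<partial>lborel)
       - 2 * pi * g (of_real r)) = 0"
    by (simp add: algebra_simps)
  then show "(\<integral>t. ?h (Complex c\<^sub>2 t) \<partial>lborel) - (\<integral>t. ?h (Complex c\<^sub>1 t) \<partial>lborel) = 2 * pi * g (of_real r)"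
    by simp
qed

text \<open>Apply the formula to \<open>(u - r) g(u)\<close>, which vanishes at \<open>r\<close>; half of the decay absorbs the
  linear factor.\<close>

lemma vertical_integral_shift:
  fixes g :: "complex \<Rightarrow> complex"
  assumes hol: "g holomorphic_on {u. Re u > a}" and ord: "a < c\<^sub>1" "c\<^sub>1 < c\<^sub>2"
    and \<delta>: "\<delta> > 0" and bound: "\<And>c t. c \<in> {c\<^sub>1..c\<^sub>2} \<Longrightarrow> norm (g (Complex c t)) \<le> A * exp (- \<delta> * \<bar>t\<bar>)"
  shows "(\<integral>t. g (Complex c\<^sub>1 t) \<partial>lborel) = (\<integral>t. g (Complex c\<^sub>2 t) \<partial>lborel)"
proof -
  define r where "r = (c\<^sub>1 + c\<^sub>2) / 2"
  have r: "c\<^sub>1 < r" "r < c\<^sub>2" using ord by (auto simp: r_def)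
  let ?g = "\<lambda>u. g u * (u - of_real r)"
  have A: "A \<ge> 0"
    using order_trans[OF norm_ge_zero bound[of c\<^sub>1 0]] ord by simp
  have "(\<integral>t. ?g (Complex c\<^sub>2 t) / (Complex c\<^sub>2 t - of_real r) \<partial>lborel) -
       (\<integral>t. ?g (Complex c\<^sub>1 t) / (Complex c\<^sub>1 t - of_real r) \<partial>lborel) = 2 * pi * ?g (of_real r)"
  proof (rule Cauchy_integral_formula_strip(2)[where A = "A * (c\<^sub>2 - c\<^sub>1 + 2 / \<delta>)" and \<delta> = "\<delta> / 2"])
    fix c t :: real assume c: "c \<in> {c\<^sub>1..c\<^sub>2}"
    have "norm (Complex c t - of_real r) \<le> \<bar>c - r\<bar> + \<bar>t\<bar>"
      using cmod_le[of "Complex c t - of_real r"] by simp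
    moreover have "\<bar>c - r\<bar> \<le> (c\<^sub>2 - c\<^sub>1) * exp (\<delta> / 2 * \<bar>t\<bar>)"
    proof -
      have "\<bar>c - r\<bar> * 1 \<le> (c\<^sub>2 - c\<^sub>1) * exp (\<delta> / 2 * \<bar>t\<bar>)"
        using c r \<delta> by (intro mult_mono) auto
      then show ?thesis by simp
    qed
    \<comment> \<open>The constant 2 / \<delta> comes from x <= exp x at x = \<delta> |t| /
      2.\<close>
    moreover have "\<bar>t\<bar> \<le> 2 / \<delta> * exp (\<delta> / 2 * \<bar>t\<bar>)"
    proof -
      have "\<delta> / 2 * \<bar>t\<bar> \<le> exp (\<delta> / 2 * \<bar>t\<bar>)"
        using exp_ge_add_one_self[of "\<delta> / 2 * \<bar>t\<bar>"] by linarith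
      then show ?thesis using \<delta> by (simp add: field_simps)
    qed
    ultimately have "norm (Complex c t - of_real r) \<le> (c\<^sub>2 - c\<^sub>1 + 2 / \<delta>) * exp (\<delta> / 2 * \<bar>t\<bar>)"
      unfolding distrib_right by linarith
    then have "norm (?g (Complex c t)) \<le> (A * exp (- \<delta> * \<bar>t\<bar>)) * ((c\<^sub>2 - c\<^sub>1 + 2 / \<delta>) * exp (\<delta> / 2 * \<bar>t\<bar>))"
      unfolding norm_mult using bound[OF c] A by (intro mult_mono) auto
    also have "\<dots> = A * (c\<^sub>2 - c\<^sub>1 + 2 / \<delta>) * (exp (- \<delta> * \<bar>t\<bar>) * exp (\<delta> / 2 * \<bar>t\<bar>))"
      by simp
    also have "exp (- \<delta> * \<bar>t\<bar>) * exp (\<delta> / 2 * \<bar>t\<bar>) = exp (- (\<delta> / 2) * \<bar>t\<bar>)"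
      unfolding exp_add[symmetric] by (simp add: field_simps)
    finally show "norm (?g (Complex c t)) \<le> A * (c\<^sub>2 - c\<^sub>1 + 2 / \<delta>) * exp (- (\<delta> / 2) * \<bar>t\<bar>)" .
  qed (use hol ord r \<delta> in \<open>auto intro!: holomorphic_intros\<close>)
  moreover have "?g (Complex c t) / (Complex c t - of_real r) = g (Complex c t)" if "c \<noteq> r" for c t
    using that by (simp add: complex_eq_iff)
  ultimately show ?thesis using r by simp
qed

subsection \<open>Power integrals on the half-line\<close>

lemma has_vector_derivative_exp_mult_ln:
  fixes s :: complex
  assumes "y > 0" "s \<noteq> 0"
  shows "((\<lambda>y. exp (s * of_real (ln y)) / s) has_vector_derivative exp ((s - 1) * of_real (ln y))) (at y)"
proof -
  have "((\<lambda>u. exp (s * Ln u) / s) has_field_derivative exp ((s - 1) * Ln (of_real y))) (at (of_real y))"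
    using assms
    by (auto intro!: derivative_eq_intros simp: left_diff_distrib exp_diff complex_nonpos_Reals_iff divide_inverse)
  from has_vector_derivative_real_field[OF this]
  have "((\<lambda>y. exp (s * Ln (of_real y)) / s) has_vector_derivative exp ((s - 1) * of_real (ln y))) (at y)"
    using assms by (simp add: Ln_of_real)
  then show ?thesis
    by (rule has_vector_derivative_transform_within_open[where S = "{0<..}"])
      (use assms in \<open>auto simp: Ln_of_real\<close>)
qed

text \<open>The integral of y^(s - 1) over the unit interval; the complex power is written as an
  exponential of \<open>ln y\<close>, so that its modulus depends on Re s alone.\<close>

lemma set_integral_exp_ln_0_1:
  fixes s :: complex
  assumes "Re s > 0"
  shows "set_integrable lborel {0<..<1} (\<lambda>y. exp ((s - 1) * of_real (ln y)))"
    and "(LBINT y:{0<..<1}. exp ((s - 1) * of_real (ln y))) = 1 / s"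
proof -
  have ein: "einterval 0 1 = {0<..<1::real}"
    by (auto simp: einterval_def zero_ereal_def one_ereal_def)
  have lim_at_0: "((\<lambda>y. exp (a * ln y)) \<longlongrightarrow> 0) (at_right 0)" if "a > 0" for a :: real
    using that
    by (intro filterlim_compose[OF exp_at_bot] filterlim_tendsto_pos_mult_at_bot[OF tendsto_const _ ln_at_0])
  \<comment> \<open>The fundamental theorem for a complex integrand presupposes integrability. It is
    obtained from the modulus, a nonnegative real power whose integrability follows from its
    antiderivative.\<close>
  have real_int: "set_integrable lborel {0<..<1} (\<lambda>y. exp ((a - 1) * ln y))" if a: "a > 0" for a :: real
    unfolding ein[symmetric]
  proof (rule interval_integral_FTC_nonneg(1))
    show "((\<lambda>y. exp (a * ln y) / a) has_real_derivative exp ((a - 1) * ln y)) (at y)"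
      if "0 < ereal y" "ereal y < 1" for y
      using that a by (auto intro!: derivative_eq_intros simp: left_diff_distrib exp_diff)
    show "(((\<lambda>y. exp (a * ln y) / a) \<circ> real_of_ereal) \<longlongrightarrow> 0 / a) (at_right 0)"
      unfolding zero_ereal_def using tendsto_divide[OF lim_at_0[OF a] tendsto_const[of a]] a
      by (simp add: ereal_tendsto_simps1)
    have "((\<lambda>y. exp (a * ln y) / a) \<longlongrightarrow> exp (a * ln 1) / a) (at_left 1)"
      using a by (intro tendsto_intros) auto
    then show "(((\<lambda>y. exp (a * ln y) / a) \<circ> real_of_ereal) \<longlongrightarrow> exp (a * ln 1) / a) (at_left 1)"
      unfolding one_ereal_def by (simp add: ereal_tendsto_simps1)
  qed (auto intro!: continuous_intros)
  show int: "set_integrable lborel {0<..<1} (\<lambda>y. exp ((s - 1) * of_real (ln y)))"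
    by (rule set_integrable_bound[OF real_int[OF assms]])
      (auto simp: set_borel_measurable_def norm_exp_eq_Re)
  have "s \<noteq> 0" using assms by auto
  have "(LBINT y=0..1. exp ((s - 1) * of_real (ln y))) = 1 / s - 0"
  proof (rule interval_integral_FTC_integrable)
    show "((\<lambda>y. exp (s * of_real (ln y)) / s) has_vector_derivative exp ((s - 1) * of_real (ln y))) (at y)"
      if "0 < ereal y" "ereal y < 1" for y
      using that \<open>s \<noteq> 0\<close> by (intro has_vector_derivative_exp_mult_ln) auto
    show "set_integrable lborel (einterval 0 1) (\<lambda>y. exp ((s - 1) * of_real (ln y)))"
      unfolding ein by (rule int)
    have "((\<lambda>y. exp (s * of_real (ln y)) / s) \<longlongrightarrow> 0) (at_right 0)"
    proof (rule tendsto_norm_zero_cancel)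
      show "((\<lambda>y. norm (exp (s * of_real (ln y)) / s)) \<longlongrightarrow> 0) (at_right 0)"
        using tendsto_divide[OF lim_at_0[OF assms] tendsto_const[of "norm s"]] \<open>s \<noteq> 0\<close>
        by (simp add: norm_divide norm_exp_eq_Re)
    qed
    then show "(((\<lambda>y. exp (s * of_real (ln y)) / s) \<circ> real_of_ereal) \<longlongrightarrow> 0) (at_right 0)"
      unfolding zero_ereal_def by (simp add: ereal_tendsto_simps1)
    have "((\<lambda>y. exp (s * of_real (ln y)) / s) \<longlongrightarrow> exp (s * of_real (ln 1)) / s) (at_left 1)"
      using \<open>s \<noteq> 0\<close> by (intro tendsto_intros) auto
    then show "(((\<lambda>y. exp (s * of_real (ln y)) / s) \<circ> real_of_ereal) \<longlongrightarrow> 1 / s) (at_left 1)"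
      unfolding one_ereal_def by (simp add: ereal_tendsto_simps1)
  qed (auto intro!: continuous_intros)
  then show "(LBINT y:{0<..<1}. exp ((s - 1) * of_real (ln y))) = 1 / s"
    by (simp add: interval_lebesgue_integral_def ein)
qed

text \<open>Counterpart on the other side of 1: the antiderivative y^s / s now vanishes at infinity
  and contributes its value at the lower end, hence the sign.\<close>

lemma set_integral_exp_ln_1_infinity:
  fixes s :: complex
  assumes "Re s < 0"
  shows "set_integrable lborel {1<..} (\<lambda>y. exp ((s - 1) * of_real (ln y)))"
    and "(LBINT y:{1<..}. exp ((s - 1) * of_real (ln y))) = - 1 / s"
proof -
  have ein: "einterval 1 \<infinity> = {1::real<..}"
    by (auto simp: einterval_def one_ereal_def)
  have lim_at_top: "((\<lambda>y. exp (a * ln y)) \<longlongrightarrow> 0) at_top" if "a < 0" for a :: real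
    using that
    by (intro filterlim_compose[OF exp_at_bot] filterlim_tendsto_neg_mult_at_bot[OF tendsto_const _ ln_at_top])
  have real_int: "set_integrable lborel {1<..} (\<lambda>y. exp ((a - 1) * ln y))" if a: "a < 0" for a :: real
    unfolding ein[symmetric]
  proof (rule interval_integral_FTC_nonneg(1))
    show "((\<lambda>y. exp (a * ln y) / a) has_real_derivative exp ((a - 1) * ln y)) (at y)"
      if "1 < ereal y" "ereal y < \<infinity>" for y
      using that a by (auto intro!: derivative_eq_intros simp: left_diff_distrib exp_diff)
    show "(((\<lambda>y. exp (a * ln y) / a) \<circ> real_of_ereal) \<longlongrightarrow> 0 / a) (at_left \<infinity>)"
      using tendsto_divide[OF lim_at_top[OF a] tendsto_const[of a]] a
      by (simp add: ereal_tendsto_simps1)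
    have "((\<lambda>y. exp (a * ln y) / a) \<longlongrightarrow> exp (a * ln 1) / a) (at_right 1)"
      using a by (intro tendsto_intros) auto
    then show "(((\<lambda>y. exp (a * ln y) / a) \<circ> real_of_ereal) \<longlongrightarrow> exp (a * ln 1) / a) (at_right 1)"
      unfolding one_ereal_def by (simp add: ereal_tendsto_simps1)
  qed (auto intro!: continuous_intros)
  show int: "set_integrable lborel {1<..} (\<lambda>y. exp ((s - 1) * of_real (ln y)))"
    by (rule set_integrable_bound[OF real_int[OF assms]])
      (auto simp: set_borel_measurable_def norm_exp_eq_Re)
  have "s \<noteq> 0" using assms by auto
  have "(LBINT y=1..\<infinity>. exp ((s - 1) * of_real (ln y))) = 0 - 1 / s"
  proof (rule interval_integral_FTC_integrable)
    show "((\<lambda>y. exp (s * of_real (ln y)) / s) has_vector_derivative exp ((s - 1) * of_real (ln y))) (at y)"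
      if "1 < ereal y" "ereal y < \<infinity>" for y
      using that \<open>s \<noteq> 0\<close> by (intro has_vector_derivative_exp_mult_ln) auto
    show "set_integrable lborel (einterval 1 \<infinity>) (\<lambda>y. exp ((s - 1) * of_real (ln y)))"
      unfolding ein by (rule int)
    have "((\<lambda>y. exp (s * of_real (ln y)) / s) \<longlongrightarrow> 0) at_top"
    proof (rule tendsto_norm_zero_cancel)
      show "((\<lambda>y. norm (exp (s * of_real (ln y)) / s)) \<longlongrightarrow> 0) at_top"
        using tendsto_divide[OF lim_at_top[OF assms] tendsto_const[of "norm s"]] \<open>s \<noteq> 0\<close>
        by (simp add: norm_divide norm_exp_eq_Re)
    qed
    then show "(((\<lambda>y. exp (s * of_real (ln y)) / s) \<circ> real_of_ereal) \<longlongrightarrow> 0) (at_left \<infinity>)"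
      by (simp add: ereal_tendsto_simps1)
    have "((\<lambda>y. exp (s * of_real (ln y)) / s) \<longlongrightarrow> exp (s * of_real (ln 1)) / s) (at_right 1)"
      using \<open>s \<noteq> 0\<close> by (intro tendsto_intros) auto
    then show "(((\<lambda>y. exp (s * of_real (ln y)) / s) \<circ> real_of_ereal) \<longlongrightarrow> 1 / s) (at_right 1)"
      unfolding one_ereal_def by (simp add: ereal_tendsto_simps1)
  qed (auto intro!: continuous_intros)
  then show "(LBINT y:{1<..}. exp ((s - 1) * of_real (ln y))) = - 1 / s"
    by (simp add: interval_lebesgue_integral_def ein)
qed

text \<open>The pieces are open because they arise as \<open>einterval\<close>; the point 1 between
  them is restored as a null summand.\<close>

lemma set_integral_split_at_1:
  fixes f :: "real \<Rightarrow> 'a :: {banach, second_countable_topology}"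
  assumes "set_integrable lborel {0<..<1} f" "set_integrable lborel {1<..} f"
  shows "set_integrable lborel {0<..} f"
    and "(LBINT y:{0<..}. f y) = (LBINT y:{0<..<1}. f y) + (LBINT y:{1<..}. f y)"
proof -
  have eq: "(\<lambda>y. indicator {0<..} y *\<^sub>R f y) = (\<lambda>y. indicator {0<..<1} y *\<^sub>R f y + indicator {1<..} y *\<^sub>R f y
      + indicator {1} y *\<^sub>R f 1)"
    by (auto simp: fun_eq_iff indicator_def)
  have one: "integrable lborel (\<lambda>y. indicator {1 :: real} y *\<^sub>R f 1)"
    by (intro integrable_scaleR_left integrable_real_indicator) auto
  show "set_integrable lborel {0<..} f"
    using assms one unfolding set_integrable_def eq by (intro Bochner_Integration.integrable_add)
  show "(LBINT y:{0<..}. f y) = (LBINT y:{0<..<1}. f y) + (LBINT y:{1<..}. f y)"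
    using assms one unfolding set_integrable_def set_lebesgue_integral_def eq by simp
qed

subsection \<open>The Mellin transform of the weight function\<close>

locale leroy =
  fixes n :: nat and \<alpha> \<beta> :: real
  assumes n_pos: "n > 0" and \<alpha>_pos: "\<alpha> > 0" and n\<alpha>_less_1: "real n * \<alpha> < 1"
begin

text \<open>The Mellin transform of the weight function, in the variable \<open>u = k s\<close> of the Mellin-Barnes
  integrand.\<close>

definition mellin :: "complex \<Rightarrow> complex" where
  "mellin u = Gamma (u + 1) * rGamma (of_real \<alpha> * u + of_real \<beta>) ^ n"

text \<open>\<open>\<Gamma>(u + 1)\<close> decays like \<open>exp (- \<pi> \<bar>Im u\<bar> / 2)\<close> and each of the \<open>n\<close> reciprocal Gamma factors grows
  like \<open>exp (\<pi> \<alpha> \<bar>Im u\<bar> / 2)\<close>, up to an arbitrarily small loss \<open>\<eta>\<close> in the exponents; \<open>\<eta>\<close> is chosen so that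
  half of the decay rate \<open>(1 - n \<alpha>) \<pi> / 2\<close> is left.\<close>

definition \<eta> where "\<eta> = (1 - real n * \<alpha>) * pi / (4 * (1 + real n * \<alpha>))"
definition \<delta> where "\<delta> = (1 - real n * \<alpha>) * pi / 4"

lemma n\<alpha>_pos: "real n * \<alpha> > 0"
  using n_pos \<alpha>_pos by simp

lemma \<eta>_pos: "\<eta> > 0"
  unfolding \<eta>_def using n\<alpha>_less_1 n\<alpha>_pos by (intro divide_pos_pos mult_pos_pos) auto

lemma \<delta>_pos: "\<delta> > 0"
  unfolding \<delta>_def using n\<alpha>_less_1 by simp

text \<open>\<eta> is chosen with \<eta> (1 + n \<alpha>) = \<delta>, and (1 - n \<alpha>) pi / 2 =
  2 \<delta>; the exponent is the difference \<delta> - 2 \<delta>.\<close>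

lemma decay_exponent: "\<eta> - pi / 2 + real n * \<alpha> * (\<eta> + pi / 2) = - \<delta>"
proof -
  have "\<eta> * (1 + real n * \<alpha>) = \<delta>"
  proof -
    have "a / (4 * b) * b = a / 4" if "b \<noteq> 0" for a b :: real
      using that by simp
    then show ?thesis using n\<alpha>_pos unfolding \<eta>_def \<delta>_def by (metis add_pos_pos less_irrefl zero_less_one)
  qed
  moreover have "4 * \<delta> = (1 - real n * \<alpha>) * pi"
    by (simp add: \<delta>_def)
  then have "real n * \<alpha> * pi = pi - 4 * \<delta>"
    by (simp add: left_diff_distrib)
  ultimately show ?thesis
    unfolding distrib_left by (simp add: mult.commute[of \<eta>] diff_divide_distrib)
qed

lemma exp_decay:
  "exp ((\<eta> - pi / 2) * \<bar>t\<bar>) * exp ((\<eta> + pi / 2) * \<bar>\<alpha> * t\<bar>) ^ n = exp (- \<delta> * \<bar>t\<bar>)"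
proof -
  have "(\<eta> - pi / 2) * \<bar>t\<bar> + real n * ((\<eta> + pi / 2) * \<bar>\<alpha> * t\<bar>) =
      (\<eta> - pi / 2 + real n * \<alpha> * (\<eta> + pi / 2)) * \<bar>t\<bar>"
    using \<alpha>_pos by (simp add: abs_mult algebra_simps)
  then show ?thesis
    unfolding exp_of_nat_mult[symmetric] exp_add[symmetric] decay_exponent by simp
qed

lemma mellin_Complex:
  "mellin (Complex c t) = Gamma (Complex (c + 1) t) * rGamma (Complex (\<alpha> * c + \<beta>) (\<alpha> * t)) ^ n"
proof -
  have "Complex c t + 1 = Complex (c + 1) t" "of_real \<alpha> * Complex c t + of_real \<beta> = Complex (\<alpha> * c + \<beta>) (\<alpha> * t)"
    by (simp_all add: complex_eq_iff)
  then show ?thesis by (simp add: mellin_def)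
qed

lemma mellin_holomorphic: "mellin holomorphic_on {u. Re u > - 1}"
  unfolding mellin_def
  by (intro holomorphic_intros) (auto elim!: nonpos_Ints_cases simp: complex_eq_iff)

lemma mellin_bound:
  assumes "- 1 < a"
  obtains A where "\<And>c t. c \<in> {a..b} \<Longrightarrow> norm (mellin (Complex c t)) \<le> A * exp (- \<delta> * \<bar>t\<bar>)"
proof -
  obtain A1 where A1: "A1 > 0"
    "\<And>s t. s \<in> {a + 1..b + 1} \<Longrightarrow> norm (Gamma (Complex s t)) \<le> A1 * exp ((\<eta> - pi / 2) * \<bar>t\<bar>)"
    using Gamma_vertical_bound[OF \<eta>_pos, of "a + 1" "b + 1"] assms by auto
  obtain A2 where A2: "A2 > 0" "\<And>s t. s \<in> {\<alpha> * a + \<beta>..\<alpha> * b + \<beta>} \<Longrightarrow>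
      norm (rGamma (Complex s t)) \<le> A2 * exp ((\<eta> + pi / 2) * \<bar>t\<bar>)"
    using rGamma_vertical_bound[OF \<eta>_pos, of "\<alpha> * a + \<beta>" "\<alpha> * b + \<beta>"] by auto
  have "norm (mellin (Complex c t)) \<le> A1 * A2 ^ n * exp (- \<delta> * \<bar>t\<bar>)" if c: "c \<in> {a..b}" for c t
  proof -
    have "norm (mellin (Complex c t)) \<le>
        (A1 * exp ((\<eta> - pi / 2) * \<bar>t\<bar>)) * (A2 * exp ((\<eta> + pi / 2) * \<bar>\<alpha> * t\<bar>)) ^ n"
      unfolding mellin_Complex norm_mult norm_power using c A1 \<alpha>_pos
      by (intro mult_mono power_mono A1(2) A2(2)) auto
    also have "\<dots> = A1 * A2 ^ n * exp (- \<delta> * \<bar>t\<bar>)"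
      unfolding exp_decay[symmetric] power_mult_distrib by simp
    finally show ?thesis .
  qed
  then show ?thesis using that by blast
qed

lemma mellin_continuous: "c > - 1 \<Longrightarrow> continuous_on {u. Re u = c} mellin"
  by (rule continuous_on_subset[OF holomorphic_on_imp_continuous_on[OF mellin_holomorphic]]) auto

lemma mellin_integrable:
  assumes "c > - 1"
  shows "integrable lborel (\<lambda>t. mellin (Complex c t))"
proof -
  obtain A where A: "\<And>c' t. c' \<in> {c..c} \<Longrightarrow> norm (mellin (Complex c' t)) \<le> A * exp (- \<delta> * \<bar>t\<bar>)"
    by (rule mellin_bound[OF assms, of c]) blast
  show ?thesis
    using assms by (intro vertical_line_integrable[OF mellin_continuous \<delta>_pos A]) auto
qed

section \<open>L1 norms of the Mellin transform on half-integer lines\<close>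

definition mellin_L1 :: "real \<Rightarrow> real" where
  "mellin_L1 c = (\<integral>t. norm (mellin (Complex c t)) \<partial>lborel)"

lemma mellin_L1_nonneg: "mellin_L1 c \<ge> 0"
  by (simp add: mellin_L1_def)

text \<open>On half-integer lines \<open>\<Gamma>(u + 1)\<close> contributes \<open>r!\<close> up to a geometric factor, and
  the reciprocal Gamma factors beat every geometric factor.\<close>

lemma mellin_L1_growth:
  assumes "\<epsilon> > 0"
  obtains C where "C \<ge> 0" "\<forall>\<^sub>F r in sequentially. mellin_L1 (real r - 1 / 2) \<le> C * fact r * \<epsilon> ^ r"
proof -
  define w where "w = 1 - exp (- \<eta>)"
  have w: "w > 0" using \<eta>_pos by (simp add: w_def)
  \<comment> \<open>Solves B^(- n \<alpha>) = \<epsilon> w: the reciprocal Gamma factors then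
    contribute (\<epsilon> w)^r, whose w^r cancels the 1 / w^r in the bound for Gamma.\<close>
  define B where "B = (\<epsilon> * w) powr (- 1 / (real n * \<alpha>))"
  have B: "B > 0" using assms w by (simp add: B_def)
  have B_powr: "B powr (- (real n * \<alpha>)) = \<epsilon> * w"
    unfolding B_def powr_powr using n_pos \<alpha>_pos assms w by simp
  define D where "D = exp (B + 1) ^ n * B powr (real n * (1 + \<alpha> / 2 - \<beta>))"
  define E where "E = (\<integral>t. exp (- \<delta> * \<bar>t\<bar>) \<partial>lborel)"
  define C where "C = sqrt (2 * pi) * exp \<eta> * D * E"
  \<comment> \<open>This threshold is equivalent to \<sigma> >= 1 below, the range of
    \<open>rGamma_le_powr\<close>.\<close>
  have "\<forall>\<^sub>F r in sequentially. (1 - \<beta>) / \<alpha> + 1 / 2 \<le> real r"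
    using filterlim_real_sequentially by (simp add: filterlim_at_top)
  moreover have "mellin_L1 (real r - 1 / 2) \<le> C * fact r * \<epsilon> ^ r"
    if r: "(1 - \<beta>) / \<alpha> + 1 / 2 \<le> real r" for r
  proof -
    define \<sigma> where "\<sigma> = \<alpha> * (real r - 1 / 2) + \<beta>"
    have \<sigma>: "\<sigma> \<ge> 1"
      using r \<alpha>_pos by (simp add: \<sigma>_def field_simps)
    then have pos: "rGamma \<sigma> > 0" by (simp add: rGamma_inverse_Gamma Gamma_real_pos)
    have "rGamma \<sigma> ^ n \<le> (exp (B + 1) * B powr (1 - \<sigma>)) ^ n"
      using rGamma_le_powr[OF B \<sigma>] pos by (intro power_mono) auto
    also have "\<dots> = exp (B + 1) ^ n * B powr (real n * (1 - \<sigma>))"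
      using B by (simp add: power_mult_distrib powr_power mult.commute)
    also have "real n * (1 - \<sigma>) = real n * (1 + \<alpha> / 2 - \<beta>) + (- (real n * \<alpha>)) * real r"
      by (simp add: \<sigma>_def algebra_simps)
    also have "B powr \<dots> = B powr (real n * (1 + \<alpha> / 2 - \<beta>)) * (\<epsilon> * w) ^ r"
      unfolding powr_add powr_powr[symmetric] B_powr using assms w by (simp add: powr_realpow)
    finally have rG: "rGamma \<sigma> ^ n \<le> D * (\<epsilon> * w) ^ r"
      by (simp add: D_def)
    have bound: "norm (mellin (Complex (real r - 1 / 2) t)) \<le>
        sqrt (2 * pi) * exp \<eta> * D * fact r * \<epsilon> ^ r * exp (- \<delta> * \<bar>t\<bar>)" for t
    proof -
      have G: "norm (Gamma (Complex (real r - 1 / 2 + 1) t)) \<le>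
          sqrt (2 * pi) * exp \<eta> * (fact r / w ^ r) * exp ((\<eta> - pi / 2) * \<bar>t\<bar>)"
        using norm_Gamma_half_integer_le[OF \<eta>_pos, of r t] by (simp add: w_def add.commute)
      have "norm (rGamma (Complex \<sigma> (\<alpha> * t))) \<le> exp (pi / 2 * \<bar>\<alpha> * t\<bar>) * rGamma \<sigma>"
        using \<sigma> by (intro norm_rGamma_le) auto
      \<comment> \<open>The exponent is weakened only to match \<open>exp_decay\<close>.\<close>
      also have "\<dots> \<le> exp ((\<eta> + pi / 2) * \<bar>\<alpha> * t\<bar>) * rGamma \<sigma>"
        using pos \<eta>_pos mult_right_mono[of "pi / 2" "\<eta> + pi / 2" "\<bar>\<alpha> * t\<bar>"]
        by (intro mult_right_mono) auto
      finally have "norm (rGamma (Complex \<sigma> (\<alpha> * t))) ^ n \<le> (exp ((\<eta> + pi / 2) * \<bar>\<alpha> * t\<bar>) * rGamma \<sigma>) ^ n"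
        by (intro power_mono) auto
      also have "\<dots> \<le> exp ((\<eta> + pi / 2) * \<bar>\<alpha> * t\<bar>) ^ n * (D * (\<epsilon> * w) ^ r)"
        unfolding power_mult_distrib[of _ "rGamma \<sigma>"] by (intro mult_left_mono rG) auto
      finally have R: "norm (rGamma (Complex \<sigma> (\<alpha> * t))) ^ n \<le> exp ((\<eta> + pi / 2) * \<bar>\<alpha> * t\<bar>) ^ n * (D * (\<epsilon> * w) ^ r)" .
      have "norm (mellin (Complex (real r - 1 / 2) t)) \<le>
          (sqrt (2 * pi) * exp \<eta> * (fact r / w ^ r) * exp ((\<eta> - pi / 2) * \<bar>t\<bar>)) *
          (exp ((\<eta> + pi / 2) * \<bar>\<alpha> * t\<bar>) ^ n * (D * (\<epsilon> * w) ^ r))"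
        unfolding mellin_Complex norm_mult norm_power \<sigma>_def[symmetric]
        using G R w by (intro mult_mono) auto
      also have "\<dots> = sqrt (2 * pi) * exp \<eta> * D * fact r * \<epsilon> ^ r *
          (exp ((\<eta> - pi / 2) * \<bar>t\<bar>) * exp ((\<eta> + pi / 2) * \<bar>\<alpha> * t\<bar>) ^ n)"
        using w by (simp add: power_mult_distrib)
      finally show ?thesis unfolding exp_decay .
    qed
    show ?thesis
    proof (cases "real r - 1 / 2 > - 1")
      case True
      then have "mellin_L1 (real r - 1 / 2) \<le>
          (\<integral>t. sqrt (2 * pi) * exp \<eta> * D * fact r * \<epsilon> ^ r * exp (- \<delta> * \<bar>t\<bar>) \<partial>lborel)"
        unfolding mellin_L1_def
        by (intro integral_mono integrable_norm mellin_integrable bound integrable_mult_right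
            integrable_exp_neg_abs \<delta>_pos) auto
      then show ?thesis by (simp add: C_def E_def mult_ac)
    qed auto
  qed
  ultimately have "\<forall>\<^sub>F r in sequentially. mellin_L1 (real r - 1 / 2) \<le> C * fact r * \<epsilon> ^ r"
    by (rule eventually_mono)
  moreover have "C \<ge> 0"
    unfolding C_def D_def E_def by (intro mult_nonneg_nonneg) auto
  ultimately show ?thesis using that by blast
qed

text \<open>The bracket bounds pi times the r-th absolute moment of the weight, so this is the
  condition for integrating the series of exp(- x y) termwise.\<close>

lemma summable_mellin_L1:
  "summable (\<lambda>r. \<bar>x\<bar> ^ r / fact r * (mellin_L1 (real r - 1 / 2) + mellin_L1 (real r + 1 / 2)))"
proof -
  \<comment> \<open>Makes the ratio |x| * 2 \<epsilon> at most 1/2. The extra 2 pays for the factor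
    r + 1 <= 2^r between (r + 1)! and r!.\<close>
  define \<epsilon> where "\<epsilon> = 1 / (4 * (\<bar>x\<bar> + 1))"
  have \<epsilon>: "\<epsilon> > 0" "\<epsilon> \<le> 1" "\<bar>x\<bar> * (2 * \<epsilon>) \<le> 1 / 2"
    by (auto simp: \<epsilon>_def field_simps)
  obtain C where C: "C \<ge> 0" and ev: "\<forall>\<^sub>F r in sequentially. mellin_L1 (real r - 1 / 2) \<le> C * fact r * \<epsilon> ^ r"
    using mellin_L1_growth[OF \<epsilon>(1)] .
  \<comment> \<open>The line r + 1/2 is the line r - 1/2 of the next index.\<close>
  have ev_Suc: "\<forall>\<^sub>F r in sequentially. mellin_L1 (real (Suc r) - 1 / 2) \<le> C * fact (Suc r) * \<epsilon> ^ Suc r"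
    using ev by (subst eventually_sequentially_Suc)
  show ?thesis
  proof (rule summable_comparison_test_ev)
    show "summable (\<lambda>r. 2 * C * (1 / 2 :: real) ^ r)"
      by (intro summable_mult summable_geometric) auto
    show "\<forall>\<^sub>F r in sequentially. norm (\<bar>x\<bar> ^ r / fact r *
        (mellin_L1 (real r - 1 / 2) + mellin_L1 (real r + 1 / 2))) \<le> 2 * C * (1 / 2) ^ r"
      using ev ev_Suc
    proof eventually_elim
      case (elim r)
      have two: "real r + 1 \<le> 2 ^ r"
        by (induction r) auto
      have "mellin_L1 (real r + 1 / 2) \<le> C * fact r * ((real r + 1) * \<epsilon> ^ Suc r)"
        using elim(2) by (simp add: algebra_simps)
      also have "(real r + 1) * \<epsilon> ^ Suc r \<le> 2 ^ r * \<epsilon> ^ r"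
        using \<epsilon> two by (intro mult_mono power_decreasing) auto
      finally have "mellin_L1 (real r + 1 / 2) \<le> C * fact r * (2 * \<epsilon>) ^ r"
        using C by (simp add: power_mult_distrib mult_left_mono)
      moreover have "C * fact r * \<epsilon> ^ r \<le> C * fact r * (2 * \<epsilon>) ^ r"
        using C \<epsilon> by (intro mult_left_mono power_mono) auto
      ultimately have "mellin_L1 (real r - 1 / 2) + mellin_L1 (real r + 1 / 2) \<le> 2 * C * fact r * (2 * \<epsilon>) ^ r"
        using elim(1) by simp
      then have "\<bar>x\<bar> ^ r / fact r * (mellin_L1 (real r - 1 / 2) + mellin_L1 (real r + 1 / 2)) \<le>
          \<bar>x\<bar> ^ r / fact r * (2 * C * fact r * (2 * \<epsilon>) ^ r)"
        by (intro mult_left_mono) auto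
      also have "\<dots> = 2 * C * (\<bar>x\<bar> * (2 * \<epsilon>)) ^ r"
        by (simp add: power_mult_distrib)
      also have "\<dots> \<le> 2 * C * (1 / 2) ^ r"
        using C \<epsilon> by (intro mult_left_mono power_mono) auto
      finally show ?case
        using mellin_L1_nonneg by (simp add: abs_mult add_nonneg_nonneg)
    qed
  qed
qed

end

subsection \<open>Moments and Laplace transform of the weight function\<close>

context leroy
begin

section \<open>Inverse Mellin transform and its independence of the line\<close>

definition inverse_mellin :: "real \<Rightarrow> real \<Rightarrow> complex" where
  "inverse_mellin c y = (\<integral>t. mellin (Complex c t) * exp (- (Complex c t + 1) * of_real (ln y)) \<partial>lborel)"

lemma norm_exp_Complex_ln: "norm (exp (- (Complex c t + 1) * of_real (ln y))) = exp (- (c + 1) * ln y)"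
  by (simp add: norm_exp_eq_Re)

lemma inverse_mellin_integrable:
  assumes "c > - 1"
  shows "integrable lborel (\<lambda>t. mellin (Complex c t) * exp (- (Complex c t + 1) * of_real (ln y)))"
proof -
  obtain A where A: "\<And>c' t. c' \<in> {c..c} \<Longrightarrow> norm (mellin (Complex c' t)) \<le> A * exp (- \<delta> * \<bar>t\<bar>)"
    by (rule mellin_bound[OF assms, of c]) blast
  show ?thesis
  proof (rule vertical_line_integrable[OF _ \<delta>_pos])
    show "continuous_on {u. Re u = c} (\<lambda>u. mellin u * exp (- (u + 1) * of_real (ln y)))"
      by (intro continuous_intros mellin_continuous assms)
    show "norm (mellin (Complex c t) * exp (- (Complex c t + 1) * of_real (ln y))) \<le>
        A * exp (- (c + 1) * ln y) * exp (- \<delta> * \<bar>t\<bar>)" for t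
      unfolding norm_mult norm_exp_Complex_ln using mult_right_mono[OF A[of c t], of "exp (- (c + 1) * ln y)"]
      by (simp add: mult_ac)
  qed
qed

lemma inverse_mellin_shift:
  assumes "- 1 < a" "a < b"
  shows "inverse_mellin a y = inverse_mellin b y"
proof -
  obtain A where A: "\<And>c t. c \<in> {a..b} \<Longrightarrow> norm (mellin (Complex c t)) \<le> A * exp (- \<delta> * \<bar>t\<bar>)"
    by (rule mellin_bound[OF assms(1), of b]) blast
  \<comment> \<open>For fixed y this bounds y^(- c - 1) simultaneously for all c in the strip,
    whether y is below or above 1.\<close>
  define M where "M = exp ((b + 1) * \<bar>ln y\<bar>)"
  show ?thesis
    unfolding inverse_mellin_def
  proof (rule vertical_integral_shift[OF _ assms \<delta>_pos])
    show "(\<lambda>u. mellin u * exp (- (u + 1) * of_real (ln y))) holomorphic_on {u. - 1 < Re u}"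
      by (intro holomorphic_intros mellin_holomorphic)
    fix c t :: real assume c: "c \<in> {a..b}"
    have "- (c + 1) * ln y \<le> (c + 1) * \<bar>ln y\<bar>"
      using c assms mult_left_mono[of "- ln y" "\<bar>ln y\<bar>" "c + 1"] by (simp add: algebra_simps)
    also have "\<dots> \<le> (b + 1) * \<bar>ln y\<bar>"
      using c by (intro mult_right_mono) auto
    finally have "norm (exp (- (Complex c t + 1) * of_real (ln y))) \<le> M"
      unfolding norm_exp_Complex_ln M_def by simp
    then have "norm (mellin (Complex c t) * exp (- (Complex c t + 1) * of_real (ln y))) \<le>
        (A * exp (- \<delta> * \<bar>t\<bar>)) * M"
      unfolding norm_mult using order_trans[OF norm_ge_zero A[OF c, of t]] by (intro mult_mono A c) auto
    then show "norm (mellin (Complex c t) * exp (- (Complex c t + 1) * of_real (ln y))) \<le>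
        A * M * exp (- \<delta> * \<bar>t\<bar>)"
      by (simp add: mult_ac)
  qed
qed

lemma inverse_mellin_eq:
  assumes "a > - 1" "b > - 1"
  shows "inverse_mellin a y = inverse_mellin b y"
proof (cases a b rule: linorder_cases)
  case less
  then show ?thesis by (rule inverse_mellin_shift[OF assms(1)])
next
  case greater
  then show ?thesis by (rule inverse_mellin_shift[OF assms(2), symmetric])
qed simp

lemma norm_inverse_mellin_le:
  assumes "c > - 1"
  shows "norm (inverse_mellin c y) \<le> exp (- (c + 1) * ln y) * mellin_L1 c"
proof -
  have "norm (inverse_mellin c y) \<le> (\<integral>t. norm (mellin (Complex c t) * exp (- (Complex c t + 1) * of_real (ln y))) \<partial>lborel)"
    unfolding inverse_mellin_def by (rule integral_norm_bound)
  also have "\<dots> = exp (- (c + 1) * ln y) * mellin_L1 c"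
    unfolding norm_mult norm_exp_Complex_ln mellin_L1_def by (simp add: mult.commute)
  finally show ?thesis .
qed

lemma Complex_measurable [measurable]: "Complex c \<in> borel_measurable borel"
  by (intro borel_measurable_continuous_onI) (auto simp: Complex_eq intro!: continuous_intros)

lemma mellin_measurable:
  assumes "c > - 1"
  shows "(\<lambda>t. mellin (Complex c t)) \<in> borel_measurable borel"
  using mellin_integrable[OF assms] by (auto dest: borel_measurable_integrable)

lemma inverse_mellin_measurable:
  assumes "c > - 1"
  shows "inverse_mellin c \<in> borel_measurable borel"
proof -
  note [measurable] = mellin_measurable[OF assms]
  have "(\<lambda>y. \<integral>t. mellin (Complex c t) * exp (- (Complex c t + 1) * of_real (ln y)) \<partial>lborel) \<in> borel_measurable lborel"
    by (rule lborel.borel_measurable_lebesgue_integral) measurable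
  then show ?thesis by (simp add: inverse_mellin_def[abs_def])
qed

text \<open>Used for the unit interval with c < r and for the rest of the half-line with c > r; S
  and the inner integral v are left abstract to serve both. Fubini applies because the modulus of
  the integrand is a product of a function of y and a function of t.\<close>

lemma inverse_mellin_moment_part:
  assumes c: "c > - 1" and S: "S \<in> sets borel" "S \<subseteq> {0<..}"
    and int: "set_integrable lborel S (\<lambda>y. exp ((real r - c - 1) * ln y))"
    and v: "\<And>t. (LBINT y:S. exp ((of_nat r - Complex c t - 1) * of_real (ln y))) = v t"
  shows "set_integrable lborel S (\<lambda>y. of_real (y ^ r) * inverse_mellin c y)"
    and "(LBINT y:S. of_real (y ^ r) * inverse_mellin c y) = (\<integral>t. mellin (Complex c t) * v t \<partial>lborel)"
    and "(LBINT y:S. norm (of_real (y ^ r) * inverse_mellin c y))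
           \<le> mellin_L1 c * (LBINT y:S. exp ((real r - c - 1) * ln y))"
proof -
  note [measurable] = mellin_measurable[OF c] inverse_mellin_measurable[OF c] S(1)
  define f :: "real \<Rightarrow> real \<Rightarrow> complex" where
    "f y t = indicator S y *\<^sub>R (mellin (Complex c t) * exp ((of_nat r - Complex c t - 1) * of_real (ln y)))" for y t
  have f_meas: "case_prod f \<in> borel_measurable (lborel \<Otimes>\<^sub>M lborel)"
    unfolding f_def by measurable
  have norm_exp: "norm (exp ((of_nat r - Complex c t - 1) * of_real (ln y))) = exp ((real r - c - 1) * ln y)" for t y
    by (simp add: norm_exp_eq_Re)
  have norm_f: "norm (f y t) = indicator S y *\<^sub>R exp ((real r - c - 1) * ln y) * norm (mellin (Complex c t))" for y t
    unfolding f_def norm_scaleR norm_mult norm_exp by (simp add: indicator_def)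
  \<comment> \<open>Merging y^r into the exponential requires y > 0, which holds on S; outside S the
    indicator makes both sides 0.\<close>
  have f_eq: "f y t = indicator S y *\<^sub>R (of_real (y ^ r) * (mellin (Complex c t) * exp (- (Complex c t + 1) * of_real (ln y))))" for y t
  proof (cases "y \<in> S")
    case True
    then have "y > 0" using S by auto
    then have "of_real (y ^ r) = exp (of_nat r * of_real (ln y) :: complex)"
      by (simp add: exp_of_nat_mult exp_of_real exp_ln)
    then have "of_real (y ^ r) * exp (- (Complex c t + 1) * of_real (ln y)) = exp ((of_nat r - Complex c t - 1) * of_real (ln y))"
      by (simp add: algebra_simps flip: exp_add)
    then show ?thesis by (simp add: f_def mult_ac)
  qed (simp add: f_def)
  have inner: "(\<integral>t. f y t \<partial>lborel) = indicator S y *\<^sub>R (of_real (y ^ r) * inverse_mellin c y)" for y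
    unfolding f_eq inverse_mellin_def using inverse_mellin_integrable[OF c, of y] by simp
  have int_f: "integrable (lborel \<Otimes>\<^sub>M lborel) (case_prod f)"
  proof (rule lborel_pair.Fubini_integrable[OF f_meas])
    have "integrable lborel (\<lambda>y. (indicator S y *\<^sub>R exp ((real r - c - 1) * ln y)) * mellin_L1 c)"
      using int unfolding set_integrable_def by (rule integrable_mult_left)
    then show "integrable lborel (\<lambda>y. \<integral>t. norm (case (y, t) of (y, t) \<Rightarrow> f y t) \<partial>lborel)"
      by (simp add: norm_f mellin_L1_def)
    show "AE y in lborel. integrable lborel (\<lambda>t. case (y, t) of (y, t) \<Rightarrow> f y t)"
      using inverse_mellin_integrable[OF c] by (simp add: f_eq)
  qed
  show set_int: "set_integrable lborel S (\<lambda>y. of_real (y ^ r) * inverse_mellin c y)"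
    using lborel_pair.integrable_fst[OF int_f] by (simp add: set_integrable_def inner)
  have "(LBINT y:S. of_real (y ^ r) * inverse_mellin c y) = (\<integral>y. \<integral>t. f y t \<partial>lborel \<partial>lborel)"
    by (simp add: set_lebesgue_integral_def inner)
  also have "\<dots> = (\<integral>t. \<integral>y. f y t \<partial>lborel \<partial>lborel)"
    using lborel_pair.Fubini_integral[OF int_f] by simp
  also have "\<dots> = (\<integral>t. mellin (Complex c t) * v t \<partial>lborel)"
  proof (rule Bochner_Integration.integral_cong[OF refl])
    fix t
    have "f y t = mellin (Complex c t) * (indicator S y *\<^sub>R exp ((of_nat r - Complex c t - 1) * of_real (ln y)))" for y
      by (simp add: f_def)
    then show "(\<integral>y. f y t \<partial>lborel) = mellin (Complex c t) * v t"
      using v[of t] by (simp only: set_lebesgue_integral_def integral_mult_right_zero)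
  qed
  finally show "(LBINT y:S. of_real (y ^ r) * inverse_mellin c y) = (\<integral>t. mellin (Complex c t) * v t \<partial>lborel)" .
  have "(LBINT y:S. norm (of_real (y ^ r) * inverse_mellin c y)) \<le>
      (LBINT y:S. mellin_L1 c * exp ((real r - c - 1) * ln y))"
  proof (rule set_integral_mono)
    show "set_integrable lborel S (\<lambda>y. norm (of_real (y ^ r) * inverse_mellin c y))"
      using set_int by (rule set_integrable_norm)
    show "set_integrable lborel S (\<lambda>y. mellin_L1 c * exp ((real r - c - 1) * ln y))"
      using int by (intro set_integrable_mult_right) auto
    fix y assume "y \<in> S"
    then have y: "y > 0" using S by auto
    then have "norm (of_real (y ^ r) * inverse_mellin c y) \<le> exp (real r * ln y) * (exp (- (c + 1) * ln y) * mellin_L1 c)"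
      unfolding norm_mult using norm_inverse_mellin_le[OF c, of y]
      by (intro mult_mono) (auto simp: exp_of_nat_mult norm_power)
    also have "\<dots> = mellin_L1 c * exp ((real r - c - 1) * ln y)"
      by (simp add: algebra_simps flip: exp_add)
    finally show "norm (of_real (y ^ r) * inverse_mellin c y) \<le> mellin_L1 c * exp ((real r - c - 1) * ln y)" .
  qed
  then show "(LBINT y:S. norm (of_real (y ^ r) * inverse_mellin c y))
           \<le> mellin_L1 c * (LBINT y:S. exp ((real r - c - 1) * ln y))"
    by simp
qed

definition weight :: "real \<Rightarrow> complex" where
  "weight y = inverse_mellin 0 y / (2 * pi)"

text \<open>The moment integral is split at \<open>y = 1\<close>, with the line of integration on either side of \<open>r\<close>;
  Cauchy's formula for the strip between the two lines recombines the parts.\<close>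

lemma weight_moment:
  shows "set_integrable lborel {0<..} (\<lambda>y. of_real (y ^ r) * weight y)"
    and "(LBINT y:{0<..}. of_real (y ^ r) * weight y) = mellin (of_nat r)"
    and "(LBINT y:{0<..}. norm (of_real (y ^ r) * weight y))
           \<le> (mellin_L1 (real r - 1 / 2) + mellin_L1 (real r + 1 / 2)) / pi"
proof -
  \<comment> \<open>Half-integer lines are those controlled by \<open>mellin_L1_growth\<close>, and
    a > -1 even for r = 0.\<close>
  define a b where "a = real r - 1 / 2" and "b = real r + 1 / 2"
  have ab: "- 1 < a" "a < real r" "real r < b" "- 1 < b" by (auto simp: a_def b_def)
  have real_part: "set_integrable lborel S (\<lambda>y. exp ((real r - c - 1) * ln y))
      \<and> (LBINT y:S. exp ((real r - c - 1) * ln y)) = v"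
    if i: "set_integrable lborel S (\<lambda>y. exp ((of_real (real r - c) - 1) * of_real (ln y) :: complex))"
      and "(LBINT y:S. exp ((of_real (real r - c) - 1) * of_real (ln y))) = complex_of_real v" for S c v
  proof -
    have eq: "exp ((of_real (real r - c) - 1) * of_real (ln y)) = complex_of_real (exp ((real r - c - 1) * ln y))" for y
      by (simp flip: exp_of_real)
    show ?thesis
      using that unfolding eq set_integral_complex_of_real of_real_eq_iff
      by (simp add: set_integrable_def complex_of_real_integrable_eq scaleR_conv_of_real flip: of_real_mult)
  qed
  \<comment> \<open>The value 2 here and in \<open>r1\<close> is the reciprocal of the distance 1/2
    between r and the line.\<close>
  have r01: "set_integrable lborel {0<..<1} (\<lambda>y. exp ((real r - a - 1) * ln y))
      \<and> (LBINT y:{0<..<1}. exp ((real r - a - 1) * ln y)) = 2"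
    using set_integral_exp_ln_0_1[of "of_real (real r - a)"]
    by (intro real_part) (auto simp: a_def)
  have r1: "set_integrable lborel {1<..} (\<lambda>y. exp ((real r - b - 1) * ln y))
      \<and> (LBINT y:{1<..}. exp ((real r - b - 1) * ln y)) = 2"
    using set_integral_exp_ln_1_infinity[of "of_real (real r - b)"]
    by (intro real_part) (auto simp: b_def)
  have c01: "(LBINT y:{0<..<1}. exp ((of_nat r - Complex a t - 1) * of_real (ln y))) = 1 / (of_nat r - Complex a t)" for t
    using ab by (intro set_integral_exp_ln_0_1) auto
  have c1: "(LBINT y:{1<..}. exp ((of_nat r - Complex b t - 1) * of_real (ln y))) = - 1 / (of_nat r - Complex b t)" for t
    using ab by (intro set_integral_exp_ln_1_infinity) auto
  note p01 = inverse_mellin_moment_part[OF ab(1) _ _ conjunct1[OF r01] c01]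
  note p1 = inverse_mellin_moment_part[OF ab(4) _ _ conjunct1[OF r1] c1]
  have W: "weight y = inverse_mellin c y / (2 * pi)" if "c > - 1" for c y
    unfolding weight_def using that inverse_mellin_eq[of 0 c y] by simp
  have ss: "{0<..<1::real} \<in> sets borel" "{0<..<1} \<subseteq> {0::real<..}" "{1::real<..} \<in> sets borel" "{1<..} \<subseteq> {0::real<..}" by auto
  let ?g = "\<lambda>y. of_real (y ^ r) * weight y"
  have g: "?g = (\<lambda>y. of_real (y ^ r) * inverse_mellin c y / (2 * pi))" if "c > - 1" for c
    using W[OF that] by simp
  have i01: "set_integrable lborel {0<..<1} ?g"
    unfolding g[OF ab(1)] by (intro set_integrable_divide p01(1) ss)
  have i1: "set_integrable lborel {1<..} ?g"
    unfolding g[OF ab(4)] by (intro set_integrable_divide p1(1) ss)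
  show "set_integrable lborel {0<..} ?g"
    by (rule set_integral_split_at_1[OF i01 i1])
  obtain A where A: "\<And>c t. c \<in> {a..b} \<Longrightarrow> norm (mellin (Complex c t)) \<le> A * exp (- \<delta> * \<bar>t\<bar>)"
    by (rule mellin_bound[OF ab(1), of b]) blast
  note strip = Cauchy_integral_formula_strip[OF mellin_holomorphic ab(1-3) \<delta>_pos A]
  have "(LBINT y:{0<..}. ?g y) = (LBINT y:{0<..<1}. ?g y) + (LBINT y:{1<..}. ?g y)"
    by (rule set_integral_split_at_1[OF i01 i1])
  also have "(LBINT y:{0<..<1}. ?g y) = (\<integral>t. mellin (Complex a t) * (1 / (of_nat r - Complex a t)) \<partial>lborel) / (2 * pi)"
    unfolding g[OF ab(1)] set_integral_divide_zero p01(2)[OF ss(1,2)] ..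
  also have "(LBINT y:{1<..}. ?g y) = (\<integral>t. mellin (Complex b t) * (- 1 / (of_nat r - Complex b t)) \<partial>lborel) / (2 * pi)"
    unfolding g[OF ab(4)] set_integral_divide_zero p1(2)[OF ss(3,4)] ..
  \<comment> \<open>Over the common denominator u - r the left line carries a minus sign and the
    right line a plus sign, as in Cauchy's formula for the strip.\<close>
  also have "(\<lambda>t. mellin (Complex a t) * (1 / (of_nat r - Complex a t))) =
      (\<lambda>t. - (mellin (Complex a t) / (Complex a t - of_real (real r))))"
    by (simp flip: divide_minus_right)
  also have "(\<lambda>t. mellin (Complex b t) * (- 1 / (of_nat r - Complex b t))) =
      (\<lambda>t. mellin (Complex b t) / (Complex b t - of_real (real r)))"
    by (simp flip: divide_minus_right)
  also have "(\<integral>t. - (mellin (Complex a t) / (Complex a t - of_real (real r))) \<partial>lborel) / (2 * pi) +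
      (\<integral>t. mellin (Complex b t) / (Complex b t - of_real (real r)) \<partial>lborel) / (2 * pi) =
      ((\<integral>t. mellin (Complex b t) / (Complex b t - of_real (real r)) \<partial>lborel) -
       (\<integral>t. mellin (Complex a t) / (Complex a t - of_real (real r)) \<partial>lborel)) / (2 * pi)"
    by (simp add: diff_divide_distrib)
  also have "\<dots> = mellin (of_nat r)"
    by (subst strip(2)) auto
  finally show "(LBINT y:{0<..}. ?g y) = mellin (of_nat r)" .
  have n01: "(LBINT y:{0<..<1}. norm (?g y)) \<le> mellin_L1 a / pi"
  proof -
    have "(LBINT y:{0<..<1}. norm (?g y)) = (LBINT y:{0<..<1}. norm (of_real (y ^ r) * inverse_mellin a y)) / (2 * pi)"
      by (simp add: W[OF ab(1)] norm_divide norm_mult)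
    also have "\<dots> \<le> mellin_L1 a * 2 / (2 * pi)"
      using p01(3)[OF ss(1,2)] r01 by (intro divide_right_mono) auto
    finally show ?thesis by simp
  qed
  have n1: "(LBINT y:{1<..}. norm (?g y)) \<le> mellin_L1 b / pi"
  proof -
    have "(LBINT y:{1<..}. norm (?g y)) = (LBINT y:{1<..}. norm (of_real (y ^ r) * inverse_mellin b y)) / (2 * pi)"
      by (simp add: W[OF ab(4)] norm_divide norm_mult)
    also have "\<dots> \<le> mellin_L1 b * 2 / (2 * pi)"
      using p1(3)[OF ss(3,4)] r1 by (intro divide_right_mono) auto
    finally show ?thesis by simp
  qed
  have "(LBINT y:{0<..}. norm (?g y)) = (LBINT y:{0<..<1}. norm (?g y)) + (LBINT y:{1<..}. norm (?g y))"
    using set_integrable_norm[OF i01] set_integrable_norm[OF i1] by (rule set_integral_split_at_1)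
  then show "(LBINT y:{0<..}. norm (?g y)) \<le> (mellin_L1 (real r - 1 / 2) + mellin_L1 (real r + 1 / 2)) / pi"
    using n01 n1 by (simp add: a_def b_def add_divide_distrib)
qed

lemma mellin_of_nat: "mellin (of_nat r) = fact r * of_real (rGamma (\<beta> + \<alpha> * real r) ^ n)"
proof -
  have "of_real \<alpha> * of_nat r + of_real \<beta> = complex_of_real (\<beta> + \<alpha> * real r)" by simp
  moreover have "Gamma (of_nat r + 1 :: complex) = fact r"
    using Gamma_fact[of r, where ?'a = complex] by (simp add: add.commute)
  ultimately show ?thesis
    by (simp only: mellin_def rGamma_complex_of_real of_real_power)
qed

text \<open>The r! in the r-th moment cancels the r! of the exponential series, leaving the Le Roy
  coefficients. Either sign of x is allowed, because the summability bound depends on |x|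
  only.\<close>

theorem laplace_weight:
  shows "set_integrable lborel {0<..} (\<lambda>y. complex_of_real (exp (- (x * y))) * weight y)"
    and "(LBINT y:{0<..}. complex_of_real (exp (- (x * y))) * weight y) =
           mittag_leffler_leroy n \<alpha> \<beta> (- complex_of_real x)"
proof -
  define f where "f r y = (of_real (- x) ^ r / fact r) * (indicator {0<..} y *\<^sub>R (of_real (y ^ r) * weight y))" for r and y :: real
  have int_f: "integrable lborel (f r)" for r
    using weight_moment(1)[of r] unfolding f_def set_integrable_def by (rule integrable_mult_right)
  have f_eq: "f r y = ((of_real (- x * y)) ^ r /\<^sub>R fact r) * (indicator {0<..} y *\<^sub>R weight y)" for r y
    unfolding f_def of_real_mult power_mult_distrib of_real_power
    by (simp add: scaleR_conv_of_real divide_inverse)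
  have sums_f: "(\<lambda>r. f r y) sums (indicator {0<..} y *\<^sub>R (complex_of_real (exp (- (x * y))) * weight y))" for y
    using sums_mult2[OF exp_converges[of "complex_of_real (- x * y)"], of "indicator {0<..} y *\<^sub>R weight y"]
    unfolding f_eq by (simp flip: exp_of_real)
  have summable_norm_f: "summable (\<lambda>r. norm (f r y))" for y
    using summable_mult2[OF summable_norm_exp[of "complex_of_real (- x * y)"], of "norm (indicator {0<..} y *\<^sub>R weight y)"]
    unfolding f_eq norm_mult .
  \<comment> \<open>Pointwise absolute convergence is that of exp; this summability of L1 norms is
    the remaining condition for exchanging sum and integral.\<close>
  have "summable (\<lambda>r. \<integral>y. norm (f r y) \<partial>lborel)"
  proof (rule summable_comparison_test)
    show "summable (\<lambda>r. \<bar>x\<bar> ^ r / fact r * (mellin_L1 (real r - 1 / 2) + mellin_L1 (real r + 1 / 2)) / pi)"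
      using summable_mellin_L1[of x] by (rule summable_divide)
    have "(\<integral>y. norm (f r y) \<partial>lborel) \<le> \<bar>x\<bar> ^ r / fact r * (mellin_L1 (real r - 1 / 2) + mellin_L1 (real r + 1 / 2)) / pi" for r
    proof -
      have "norm (f r y) = (\<bar>x\<bar> ^ r / fact r) * (indicator {0<..} y *\<^sub>R norm (of_real (y ^ r) * weight y))" for y
        by (simp add: f_def norm_mult norm_divide norm_power)
      then have "(\<integral>y. norm (f r y) \<partial>lborel) = \<bar>x\<bar> ^ r / fact r * (LBINT y:{0<..}. norm (of_real (y ^ r) * weight y))"
        by (simp add: set_lebesgue_integral_def)
      also have "\<dots> \<le> \<bar>x\<bar> ^ r / fact r * ((mellin_L1 (real r - 1 / 2) + mellin_L1 (real r + 1 / 2)) / pi)"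
        by (intro mult_left_mono weight_moment(3)) auto
      finally show ?thesis by simp
    qed
    then show "\<exists>N. \<forall>r\<ge>N. norm (\<integral>y. norm (f r y) \<partial>lborel) \<le>
        \<bar>x\<bar> ^ r / fact r * (mellin_L1 (real r - 1 / 2) + mellin_L1 (real r + 1 / 2)) / pi"
      by auto
  qed
  note interchange = int_f AE_I2[OF summable_norm_f] this
  have suminf_f: "(\<lambda>y. \<Sum>r. f r y) = (\<lambda>y. indicator {0<..} y *\<^sub>R (complex_of_real (exp (- (x * y))) * weight y))"
    using sums_f by (auto simp: sums_iff)
  show "set_integrable lborel {0<..} (\<lambda>y. complex_of_real (exp (- (x * y))) * weight y)"
    unfolding set_integrable_def suminf_f[symmetric] by (rule integrable_suminf[OF interchange])
  have "(LBINT y:{0<..}. complex_of_real (exp (- (x * y))) * weight y) = (\<Sum>r. \<integral>y. f r y \<partial>lborel)"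
    unfolding set_lebesgue_integral_def suminf_f[symmetric] by (rule integral_suminf[OF interchange])
  also have "(\<lambda>r. \<integral>y. f r y \<partial>lborel) = (\<lambda>r. (- complex_of_real x) ^ r * of_real (rGamma (\<beta> + \<alpha> * real r) ^ n))"
  proof
    fix r
    have "(\<integral>y. f r y \<partial>lborel) = of_real (- x) ^ r / fact r * (LBINT y:{0<..}. of_real (y ^ r) * weight y)"
      unfolding f_def set_lebesgue_integral_def by (rule integral_mult_right_zero)
    also have "\<dots> = (- complex_of_real x) ^ r * of_real (rGamma (\<beta> + \<alpha> * real r) ^ n)"
      unfolding weight_moment(2) mellin_of_nat by simp
    finally show "(\<integral>y. f r y \<partial>lborel) = \<dots>" .
  qed
  finally show "(LBINT y:{0<..}. complex_of_real (exp (- (x * y))) * weight y) =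
           mittag_leffler_leroy n \<alpha> \<beta> (- complex_of_real x)"
    by (simp add: mittag_leffler_leroy_def)
qed

end

subsection \<open>The weight function as a Meijer G function\<close>

text \<open>Gauss's formula at z = s + 1/k, inverted; the shift yields Gamma(k s + 1) and one extra
  factor k. It holds at the poles too, where \<open>Gamma\<close> is 0 as the inverse of
  \<open>rGamma\<close>.\<close>

lemma prod_Gamma_Delta:
  fixes s :: complex
  assumes "k > 0"
  shows "(\<Prod>i<k. Gamma (map complex_of_real (Delta k 1) ! i + s)) =
           of_real ((2 * pi) powr ((real k - 1) / 2) * real k powr (- 1 / 2)) *
           exp (- (of_nat k * s) * of_real (ln (real k))) * Gamma (of_nat k * s + 1)"
proof -
  have "(\<Prod>i<k. Gamma (map complex_of_real (Delta k 1) ! i + s)) =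
      (\<Prod>i<k. inverse (rGamma (s + 1 / of_nat k + of_nat i / of_nat k)))"
    by (intro prod.cong) (auto simp: Delta_def Gamma_def add_divide_distrib add_ac)
  also have "\<dots> = inverse (\<Prod>i<k. rGamma (s + 1 / of_nat k + of_nat i / of_nat k))"
    by (simp add: prod_inversef[symmetric] o_def)
  also have "\<dots> = inverse (of_real ((2 * pi) powr ((1 - real k) / 2) * real k powr (- 1 / 2)) *
           exp (of_nat k * (s + 1 / of_nat k) * of_real (ln (real k))) * rGamma (of_nat k * (s + 1 / of_nat k)))"
    by (simp only: rGamma_Gauss_multiplication[OF assms])
  also have "of_nat k * (s + 1 / of_nat k) = of_nat k * s + 1"
    using assms by (simp add: distrib_left)
  also have "exp ((of_nat k * s + 1) * of_real (ln (real k))) = exp (of_nat k * s * of_real (ln (real k))) * of_real (real k)"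
    using assms by (simp add: distrib_right exp_add exp_of_real)
  also have "inverse (of_real ((2 * pi) powr ((1 - real k) / 2) * real k powr (- 1 / 2)) *
      (exp (of_nat k * s * of_real (ln (real k))) * of_real (real k)) * rGamma (of_nat k * s + 1)) =
      of_real (inverse ((2 * pi) powr ((1 - real k) / 2) * (real k powr (- 1 / 2) * real k))) *
      exp (- (of_nat k * s) * of_real (ln (real k))) * Gamma (of_nat k * s + 1)"
    by (simp add: Gamma_def exp_minus)
  also have "inverse ((2 * pi) powr ((1 - real k) / 2) * (real k powr (- 1 / 2) * real k)) =
      (2 * pi) powr ((real k - 1) / 2) * real k powr (- 1 / 2)"
  proof -
    have "real k powr (- 1 / 2) * real k = real k powr (1 / 2)"
      using assms powr_add[of "real k" "- 1 / 2" 1] by simp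
    moreover have "(real k - 1) / 2 = - ((1 - real k) / 2)" unfolding minus_divide_left by simp
    ultimately show ?thesis
      by (simp only: powr_minus inverse_mult_distrib divide_minus_left minus_divide_left[symmetric])
  qed
  finally show ?thesis .
qed

text \<open>Gauss's formula at z = s + \<beta>/l; the shift produces the factor l^\<beta>.\<close>

lemma prod_rGamma_Delta:
  fixes s :: complex
  assumes "l > 0"
  shows "(\<Prod>j<l. rGamma (complex_of_real (Delta l \<beta> ! j) + s)) =
           of_real ((2 * pi) powr ((1 - real l) / 2) * real l powr (\<beta> - 1 / 2)) *
           exp (of_nat l * s * of_real (ln (real l))) * rGamma (of_nat l * s + of_real \<beta>)"
proof -
  have "(\<Prod>j<l. rGamma (complex_of_real (Delta l \<beta> ! j) + s)) =
      (\<Prod>j<l. rGamma (s + of_real \<beta> / of_nat l + of_nat j / of_nat l))"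
    by (intro prod.cong) (auto simp: Delta_def add_divide_distrib add_ac)
  also have "\<dots> = of_real ((2 * pi) powr ((1 - real l) / 2) * real l powr (- 1 / 2)) *
      exp (of_nat l * (s + of_real \<beta> / of_nat l) * of_real (ln (real l))) *
      rGamma (of_nat l * (s + of_real \<beta> / of_nat l))"
    by (rule rGamma_Gauss_multiplication[OF assms])
  also have "of_nat l * (s + of_real \<beta> / of_nat l) = of_nat l * s + of_real \<beta>"
    using assms by (simp add: distrib_left)
  also have "exp ((of_nat l * s + of_real \<beta>) * of_real (ln (real l))) =
      exp (of_nat l * s * of_real (ln (real l))) * of_real (real l powr \<beta>)"
    using assms by (simp add: distrib_right exp_add powr_def flip: exp_of_real)
  also have "of_real ((2 * pi) powr ((1 - real l) / 2) * real l powr (- 1 / 2)) *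
      (exp (of_nat l * s * of_real (ln (real l))) * of_real (real l powr \<beta>)) * rGamma (of_nat l * s + of_real \<beta>) =
      of_real ((2 * pi) powr ((1 - real l) / 2) * (real l powr (- 1 / 2) * real l powr \<beta>)) *
      exp (of_nat l * s * of_real (ln (real l))) * rGamma (of_nat l * s + of_real \<beta>)"
    by simp
  also have "real l powr (- 1 / 2) * real l powr \<beta> = real l powr (\<beta> - 1 / 2)"
    by (simp flip: powr_add)
  finally show ?thesis .
qed

lemma prod_rGamma_concat_replicate:
  "(\<Prod>i = 0..<length (map complex_of_real (concat (replicate n xs))).
      rGamma (map complex_of_real (concat (replicate n xs)) ! i + s)) =
   (\<Prod>j<length xs. rGamma (complex_of_real (xs ! j) + s)) ^ n"
proof -
  define f where "f x = rGamma (complex_of_real x + s)" for x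
  have list: "(\<Prod>i = 0..<length ys. f (ys ! i)) = prod_list (map f ys)" for ys
    by (simp add: prod.list_conv_set_nth)
  have "(\<Prod>i = 0..<length (map complex_of_real (concat (replicate n xs))).
      rGamma (map complex_of_real (concat (replicate n xs)) ! i + s)) =
      prod_list (map f (concat (replicate n xs)))"
    unfolding list[symmetric] by (intro prod.cong) (auto simp: f_def)
  also have "\<dots> = prod_list (map f xs) ^ n"
    by (induction n) auto
  also have "prod_list (map f xs) = (\<Prod>j<length xs. rGamma (complex_of_real (xs ! j) + s))"
    unfolding list[symmetric] by (simp add: f_def atLeast0LessThan)
  finally show ?thesis .
qed

text \<open>The rightmost pole of the numerator is s = -1/k, from the first entry 1/k of
  \<open>Delta k 1\<close>. Under u = k s the admissible lines are exactly Re u > -1.\<close>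

lemma separates_poles_Delta_iff:
  assumes "k > 0"
  shows "separates_poles k 0 as (map complex_of_real (Delta k 1)) c \<longleftrightarrow> c > - 1 / real k"
proof
  assume "separates_poles k 0 as (map complex_of_real (Delta k 1)) c"
  then have "map complex_of_real (Delta k 1) ! 0 + complex_of_real (- 1 / real k) \<in> \<int>\<^sub>\<le>\<^sub>0 \<longrightarrow>
      Re (complex_of_real (- 1 / real k)) < c"
    using assms unfolding separates_poles_def by blast
  then show "c > - 1 / real k"
    using assms by (simp add: Delta_def)
next
  assume c: "c > - 1 / real k"
  have "Re s < c" if "i < k" "map complex_of_real (Delta k 1) ! i + s \<in> \<int>\<^sub>\<le>\<^sub>0" for i s
  proof -
    have "complex_of_real ((1 + real i) / real k) + s \<in> \<int>\<^sub>\<le>\<^sub>0"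
      using that by (simp add: Delta_def)
    then obtain m where "complex_of_real ((1 + real i) / real k) + s = of_int m" "m \<le> 0"
      by (elim nonpos_Ints_cases)
    then have "Re (complex_of_real ((1 + real i) / real k) + s) \<le> 0"
      by simp
    then have "Re s \<le> - ((1 + real i) / real k)" by simp
    also have "\<dots> \<le> - 1 / real k"
      using assms by (simp add: field_simps)
    finally show ?thesis using c by simp
  qed
  then show "separates_poles k 0 as (map complex_of_real (Delta k 1)) c"
    by (auto simp: separates_poles_def)
qed

text \<open>The scaling l^(n l) / k^k of the argument is what cancels the s-dependent exponentials
  l^(n l s) and k^(- k s) that Gauss's formula produces.\<close>

lemma leroy_meijer_G_integrand:
  fixes s :: complex
  assumes "l > 0" "k > 0" "y > 0"
  shows "meijer_G_integrand k 0 (map complex_of_real (concat (replicate n (Delta l \<beta>))))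
           (map complex_of_real (Delta k 1)) (complex_of_real (real l ^ (n * l) * y ^ k / real k ^ k)) s =
         of_real ((2 * pi) powr ((real k - 1) / 2 + real n * (1 - real l) / 2) * real k powr (- 1 / 2) *
           real l powr (real n * (\<beta> - 1 / 2))) *
         (Gamma (of_nat k * s + 1) * rGamma (of_nat l * s + of_real \<beta>) ^ n * exp (- (of_nat k * s) * of_real (ln y)))"
    (is "meijer_G_integrand k 0 ?as ?bs ?z s = _")
proof -
  have len: "length (Delta l \<beta>) = l" "length ?bs = k" by (auto simp: Delta_def)
  have num: "(\<Prod>i = 0..<length ?as. rGamma (?as ! i + s)) =
      (of_real ((2 * pi) powr ((1 - real l) / 2) * real l powr (\<beta> - 1 / 2)) *
       exp (of_nat l * s * of_real (ln (real l))) * rGamma (of_nat l * s + of_real \<beta>)) ^ n"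
    unfolding prod_rGamma_concat_replicate len prod_rGamma_Delta[OF assms(1)] ..
  have z: "real l ^ (n * l) * y ^ k / real k ^ k > 0"
    using assms by simp
  have "ln (real l ^ (n * l) * y ^ k / real k ^ k) = real n * (real l * ln (real l)) + real k * ln y - real k * ln (real k)"
    using assms by (simp add: ln_mult ln_div ln_realpow)
  then have "?z powr (- s) = exp (- s * of_real (real n * (real l * ln (real l)) + real k * ln y - real k * ln (real k)))"
    using z assms unfolding powr_def by (subst Ln_of_real[OF z]) (auto simp: complex_eq_iff)
  also have "- s * of_real (real n * (real l * ln (real l)) + real k * ln y - real k * ln (real k)) =
     - (of_nat n * (of_nat l * s * of_real (ln (real l)))) + (- (of_nat k * s) * of_real (ln y)) +
     of_nat k * s * of_real (ln (real k))"
    by (simp add: algebra_simps)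
  also have "exp \<dots> = inverse (exp (of_nat l * s * of_real (ln (real l))) ^ n) * exp (- (of_nat k * s) * of_real (ln y)) *
     inverse (exp (- (of_nat k * s) * of_real (ln (real k))))"
    by (simp only: exp_add exp_minus exp_of_nat_mult mult_minus_left inverse_inverse_eq)
  finally have z_powr: "?z powr (- s) = \<dots>" .
  have const: "(2 * pi) powr ((real k - 1) / 2 + real n * (1 - real l) / 2) * real k powr (- 1 / 2) *
      real l powr (real n * (\<beta> - 1 / 2)) = (2 * pi) powr ((real k - 1) / 2) * real k powr (- 1 / 2) *
      ((2 * pi) powr ((1 - real l) / 2) * real l powr (\<beta> - 1 / 2)) ^ n"
    using assms by (simp add: powr_add power_mult_distrib powr_power mult_ac)
  \<comment> \<open>Here X stands for k^(- k s), E for l^(l s) and Y for y^(- k s).\<close>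
  have cancel: "A * X * g * (B * E * R) ^ n * (inverse (E ^ n) * Y * inverse X) = A * B ^ n * (g * R ^ n * Y)"
    if "X \<noteq> 0" "E \<noteq> 0" for A B E R X Y g :: complex
    using that by (simp add: power_mult_distrib field_simps)
  have "meijer_G_integrand k 0 ?as ?bs ?z s =
      (\<Prod>i<k. Gamma (?bs ! i + s)) * (\<Prod>i = 0..<length ?as. rGamma (?as ! i + s)) * ?z powr (- s)"
    unfolding meijer_G_integrand_def len by simp
  also have "\<dots> = of_real ((2 * pi) powr ((real k - 1) / 2) * real k powr (- 1 / 2)) *
      of_real (((2 * pi) powr ((1 - real l) / 2) * real l powr (\<beta> - 1 / 2)) ^ n) *
      (Gamma (of_nat k * s + 1) * rGamma (of_nat l * s + of_real \<beta>) ^ n * exp (- (of_nat k * s) * of_real (ln y)))"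
    unfolding num z_powr prod_Gamma_Delta[OF assms(2)] of_real_power by (rule cancel) simp_all
  finally show ?thesis
    unfolding const of_real_mult .
qed

text \<open>Substituting u = k s turns the Mellin-Barnes integral into the inverse Mellin integral;
  the Jacobian contributes 1/k.\<close>

lemma leroy_weight_eq:
  assumes "leroy n (real l / real k)" "l > 0" "k > 0" "y > 0"
  shows "leroy_weight l k \<beta> n y = leroy.weight n (real l / real k) \<beta> y"
proof -
  interpret leroy n "real l / real k" \<beta> by fact
  define M where "M = (2 * pi) powr ((real k - 1) / 2 + real n * (1 - real l) / 2) * real k powr (- 1 / 2) *
      real l powr (real n * (\<beta> - 1 / 2))"
  let ?as = "map complex_of_real (concat (replicate n (Delta l \<beta>)))"
  let ?bs = "map complex_of_real (Delta k 1)"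
  let ?z = "complex_of_real (real l ^ (n * l) * y ^ k / real k ^ k)"
  let ?G = "\<lambda>c t. meijer_G_integrand k 0 ?as ?bs ?z (Complex c t)"
  define q where "q c t = mellin (Complex c t) * exp (- (Complex c t + 1) * of_real (ln y))" for c t
  \<comment> \<open>The factor y compensates the exponent - (u + 1) in \<open>q\<close>. The form
    \<open>0 + real k * t\<close> is that of the affine change of variables.\<close>
  have G: "?G c t = of_real (M * y) * q (real k * c) (0 + real k * t)" for c t
  proof -
    have "of_nat k * Complex c t = Complex (real k * c) (real k * t)"
      by (simp add: complex_eq_iff)
    moreover have "of_real (real l / real k) * (of_nat k * Complex c t) = of_nat l * Complex c t"
      using assms by simp
    moreover have "exp (- (u + 1) * of_real (ln y)) = exp (- u * of_real (ln y)) / of_real y" for u :: complex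
      using assms by (simp add: left_diff_distrib exp_diff exp_of_real)
    ultimately show ?thesis
      using assms unfolding leroy_meijer_G_integrand[OF assms(2-4)] M_def[symmetric] q_def mellin_def
      by (simp add: mult_ac)
  qed
  have q_int: "integrable lborel (q c)" if "c > - 1" for c
    unfolding q_def using that by (rule inverse_mellin_integrable)
  have G_int: "integrable lborel (?G c)" if "c > - 1 / real k" for c
    unfolding G using assms that
    by (intro integrable_mult_right lborel_integrable_real_affine q_int) (auto simp: field_simps)
  have G_value: "1 / (2 * complex_of_real pi * \<i>) * (\<integral>t. ?G c t * \<i> \<partial>lborel) = of_real (M * y / real k) * weight y"
    if c: "c > - 1 / real k" for c
  proof -
    have kc: "real k * c > - 1" using c assms by (simp add: field_simps)
    have "(\<integral>t. q (real k * c) (0 + real k * t) \<partial>lborel) = inverse_mellin (real k * c) y / of_nat k"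
      using lborel_integral_real_affine[of "real k" "q (real k * c)" 0] assms
      by (simp add: inverse_mellin_def q_def[abs_def] scaleR_conv_of_real)
    then have "(\<integral>t. ?G c t * \<i> \<partial>lborel) = of_real (M * y) * (inverse_mellin 0 y / of_nat k) * \<i>"
      unfolding G integral_mult_left_zero integral_mult_right_zero
      using inverse_mellin_eq[OF kc, of 0 y] by simp
    then show ?thesis
      by (simp add: weight_def)
  qed
  \<comment> \<open>The equivalence for all w is what evaluates the definite description: existence
    from the line c = 0, uniqueness from \<open>G_value\<close> on every admissible line.\<close>
  have "has_meijer_G k 0 ?as ?bs ?z w \<longleftrightarrow> w = of_real (M * y / real k) * weight y" for w
    unfolding has_meijer_G_def separates_poles_Delta_iff[OF assms(3)]
  proof safe
    fix c assume "- 1 / real k < c"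
    then show "1 / (2 * complex_of_real pi * \<i>) * (\<integral>t. ?G c t * \<i> \<partial>lborel) = of_real (M * y / real k) * weight y"
      by (rule G_value)
  next
    have "- 1 / real k < (0 :: real)" using assms by simp
    then show "\<exists>c > - 1 / real k. integrable lborel (?G c) \<and>
        of_real (M * y / real k) * weight y = 1 / (2 * complex_of_real pi * \<i>) * (\<integral>t. ?G c t * \<i> \<partial>lborel)"
      using G_int G_value by metis
  qed
  then have meijer: "meijer_G k 0 ?as ?bs ?z = of_real (M * y / real k) * weight y"
    by (simp add: meijer_G_def)
  \<comment> \<open>It remains to see that the prefactor in \<open>leroy_weight\<close> is the
    reciprocal of M y / k.\<close>
  have "(2 * pi) powr ((1 - real k) / 2 - real n * (1 - real l) / 2) *
      (2 * pi) powr ((real k - 1) / 2 + real n * (1 - real l) / 2) = 1"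
    by (simp add: diff_divide_distrib flip: powr_add)
  moreover have "real k powr (3 / 2) * real k powr (- 1 / 2) = real k"
    using assms by (simp flip: powr_add)
  ultimately have "(2 * pi) powr ((1 - real k) / 2 - real n * (1 - real l) / 2) *
      (real k powr (3 / 2) / real l powr (real n * (\<beta> - 1 / 2))) * (1 / y) * (M * y / real k) = 1"
    using assms unfolding M_def by (simp add: field_simps)
  then show ?thesis
    unfolding leroy_weight_def meijer mult.assoc[symmetric] of_real_mult[symmetric] by simp
qed

theorem theorem1:
  fixes n l k :: nat and \<beta> x :: real
  assumes "n > 0" and "l > 0" and "k > 0"
    and "real l / real k < 1 / real n"
  shows "set_integrable lborel {0<..}
           (\<lambda>y. complex_of_real (exp (- (x * y))) * leroy_weight l k \<beta> n y) \<and>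
         mittag_leffler_leroy n (real l / real k) \<beta> (- complex_of_real x) =
           (LBINT y:{0<..}. complex_of_real (exp (- (x * y))) * leroy_weight l k \<beta> n y)"
proof -
  have leroy: "leroy n (real l / real k)"
    using assms by unfold_locales (auto simp: field_simps)
  then interpret leroy n "real l / real k" \<beta> .
  have eq: "complex_of_real (exp (- (x * y))) * leroy_weight l k \<beta> n y =
      complex_of_real (exp (- (x * y))) * weight y" if "y \<in> {0<..}" for y
    using that leroy_weight_eq[OF leroy assms(2,3)] by simp
  have "set_integrable lborel {0<..} (\<lambda>y. complex_of_real (exp (- (x * y))) * leroy_weight l k \<beta> n y)"
    using laplace_weight(1)[of x] by (rule set_integrable_cong[THEN iffD2, rotated -1]) (auto simp: eq)
  moreover have "(LBINT y:{0<..}. complex_of_real (exp (- (x * y))) * leroy_weight l k \<beta> n y) =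
      (LBINT y:{0<..}. complex_of_real (exp (- (x * y))) * weight y)"
    by (intro set_lebesgue_integral_cong) (auto simp: eq)
  ultimately show ?thesis
    using laplace_weight(2)[of x] by simp
qed

end
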